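(* Let $n\ge3$ and suppose $w=[w_{[i_1,\dots,i_n]}]\in\mathbb C^{2^n}$ with $i_j\in\{0,1\}$. Then $w$ represents the principal minors of a symmetric $n\times n$ matrix if and only if $w$ and all its images under changes of coordinates by $\left(\mathrm{SL}(2)^{\times n}\right)\ltimes\mathfrak S_n$ are zeros of Cayley's $2\times2\times2$ hyperdeterminant $$\begin{aligned}&w_{I_{[0,0,0]}}^{2}w_{I_{[1,1,1]}}^{2}+w_{I_{[1,0,0]}}^{2}w_{I_{[0,1,1]}}^{2}+w_{I_{[0,1,0]}}^{2}w_{I_{[1,0,1]}}^{2}+w_{I_{[0,0,1]}}^{2}w_{I_{[1,1,0]}}^{2}\\&-2w_{I_{[0,0,0]}}w_{I_{[1,0,0]}}w_{I_{[0,1,1]}}w_{I_{[1,1,1]}}-2w_{I_{[0,0,0]}}w_{I_{[0,1,0]}}w_{I_{[1,0,1]}}w_{I_{[1,1,1]}}-2w_{I_{[0,0,0]}}w_{I_{[0,0,1]}}w_{I_{[1,1,0]}}w_{I_{[1,1,1]}}\\&-2w_{I_{[1,0,0]}}w_{I_{[0,1,0]}}w_{I_{[0,1,1]}}w_{I_{[1,0,1]}}-2w_{I_{[1,0,0]}}w_{I_{[0,0,1]}}w_{I_{[0,1,1]}}w_{I_{[1,1,0]}}-2w_{I_{[0,1,0]}}w_{I_{[0,0,1]}}w_{I_{[1,0,1]}}w_{I_{[1,1,0]}}\\&+4w_{I_{[0,0,0]}}w_{I_{[0,1,1]}}w_{I_{[1,0,1]}}w_{I_{[1,1,0]}}+4w_{I_{[0,0,1]}}w_{I_{[0,1,0]}}w_{I_{[1,0,0]}}w_{I_{[1,1,1]}},\end{aligned}$$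 where $I_{[i_1,i_2,i_3]}=[i_1,i_2,i_3,0,\dots,0]$ for $i_j\in\{0,1\}$.
   Context: The space $\mathbb C^{2^n}$ is identified with $(\mathbb C^2)^{\otimes n}$: if $x_k^0,x_k^1$ is the basis of the $k$-th copy of $\mathbb C^2$ and $X^I=x_1^{i_1}\otimes\cdots\otimes x_n^{i_n}$ for a binary multi-index $I=[i_1,\dots,i_n]$, then $w$ corresponds to $\sum_I w_IX^I$. The group $\left(\mathrm{SL}(2)^{\times n}\right)\ltimes\mathfrak S_n$ acts on $(\mathbb C^2)^{\otimes n}$ with $\mathrm{SL}(2)^{\times n}$ acting factor by factor and $\mathfrak S_n$ permuting the tensor factors. For a symmetric $n\times n$ complex matrix $A$, $\Delta_I(A)$ is the principal minor of $A$ on the rows and columns $k$ with $i_k=1$ (with $\Delta_{[0,\dots,0]}(A)=1$), and $|I|=\sum_k i_k$. Vectors of principal minors are considered projectively: the variety of principal minors of symmetric $n\times n$ matrices is the projective variety $Z_n\subset\mathbb P((\mathbb C^2)^{\otimes n})$ defined as the (closure of the) image of the rational map $[A,t]\mapsto\left[\sum_I t^{\,n-|I|}\Delta_I(A)X^I\right]$, where $A$ is a symmetric $n\times n$ matrix and $t\in\mathbb C$. That $w$ represents the principal minors of a symmetric matrix is understood in this sense: $w$ lies in the cone over $Z_n$. *)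

theory Defs
  imports
    "HOL-Combinatorics.Permutations"
    "Jordan_Normal_Form.Determinant"
    "Jordan_Normal_Form.DL_Submatrix"
begin

text \<open>Tensor factors, matrix rows and matrix columns are numbered \<open>0, \<dots>, n - 1\<close>; thus the
  entry \<open>I ! k\<close> of a multi-index is $i_{k+1}$ in one-based notation.\<close>

definition multi_indices :: "nat \<Rightarrow> nat list set" where
  "multi_indices n = {I. length I = n \<and> set I \<subseteq> {0, 1}}"

text \<open>The element $\sum_I w_I X^I$ of $(\mathbb{C}^2)^{\otimes n}$ is represented by its coordinate
  function $I \mapsto w_I$, which is required to be zero outside the multi-indices so that equality
  of tensors is equality of functions.\<close>

type_synonym tensor = "nat list \<Rightarrow> complex"

definition tensors :: "nat \<Rightarrow> tensor set" where
  "tensors n = {w. \<forall>I. I \<notin> multi_indices n \<longrightarrow> w I = 0}"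

definition SL2 :: "complex mat set" where
  "SL2 = {g \<in> carrier_mat 2 2. det g = 1}"

text \<open>Applying $g_k$ in the $k$-th factor, where $g_k x_k^j = \sum_i (g_k)_{ij} x_k^i$.\<close>

definition sl2_act :: "nat \<Rightarrow> (nat \<Rightarrow> complex mat) \<Rightarrow> tensor \<Rightarrow> tensor" where
  "sl2_act n g w = (\<lambda>I. if I \<in> multi_indices n
     then (\<Sum>J\<in>multi_indices n. (\<Prod>k<n. g k $$ (I ! k, J ! k)) * w J) else 0)"

text \<open>The permutation \<open>p\<close> moves the \<open>k\<close>-th tensor factor to position \<open>p k\<close>: it sends
  $X^J$ to $X^I$ with \<open>I ! p k = J ! k\<close>, i.e. with \<open>J = permute_list p I\<close>.\<close>

definition perm_act :: "nat \<Rightarrow> (nat \<Rightarrow> nat) \<Rightarrow> tensor \<Rightarrow> tensor" where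
  "perm_act n p w = (\<lambda>I. if I \<in> multi_indices n then w (permute_list p I) else 0)"

text \<open>Every element of the semidirect product is a product of an element of $SL(2)^{\times n}$ and
  a permutation, so the following is the orbit of \<open>w\<close> under the whole group.\<close>

definition orbit_tensor :: "nat \<Rightarrow> tensor \<Rightarrow> tensor set" where
  "orbit_tensor n w = {sl2_act n g (perm_act n p w) | g p.
     (\<forall>k<n. g k \<in> SL2) \<and> p permutes {..<n}}"

definition hyperdet :: "nat \<Rightarrow> tensor \<Rightarrow> complex" where
  "hyperdet n w = (let a = (\<lambda>i j k. w ([i, j, k] @ replicate (n - 3) 0)) in
     (a 0 0 0)^2 * (a 1 1 1)^2 + (a 1 0 0)^2 * (a 0 1 1)^2
   + (a 0 1 0)^2 * (a 1 0 1)^2 + (a 0 0 1)^2 * (a 1 1 0)^2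
   - 2 * a 0 0 0 * a 1 0 0 * a 0 1 1 * a 1 1 1
   - 2 * a 0 0 0 * a 0 1 0 * a 1 0 1 * a 1 1 1
   - 2 * a 0 0 0 * a 0 0 1 * a 1 1 0 * a 1 1 1
   - 2 * a 1 0 0 * a 0 1 0 * a 0 1 1 * a 1 0 1
   - 2 * a 1 0 0 * a 0 0 1 * a 0 1 1 * a 1 1 0
   - 2 * a 0 1 0 * a 0 0 1 * a 1 0 1 * a 1 1 0
   + 4 * a 0 0 0 * a 0 1 1 * a 1 0 1 * a 1 1 0
   + 4 * a 0 0 1 * a 0 1 0 * a 1 0 0 * a 1 1 1)"

definition symmetric_mats :: "nat \<Rightarrow> complex mat set" where
  "symmetric_mats n = {A \<in> carrier_mat n n. transpose_mat A = A}"

definition principal_minor :: "complex mat \<Rightarrow> nat list \<Rightarrow> complex" where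
  "principal_minor A I =
     (let S = {k. k < length I \<and> I ! k = 1} in det (submatrix A S S))"

definition minor_vector :: "nat \<Rightarrow> complex mat \<Rightarrow> complex \<Rightarrow> tensor" where
  "minor_vector n A t = (\<lambda>I. if I \<in> multi_indices n
     then t ^ (n - sum_list I) * principal_minor A I else 0)"

text \<open>A point of projective space is the set of its nonzero representatives.\<close>

definition proj_point :: "tensor \<Rightarrow> tensor set" where
  "proj_point w = {\<lambda>I. c * w I | c. c \<noteq> 0}"

definition proj_space :: "nat \<Rightarrow> tensor set set" where
  "proj_space n = proj_point ` (tensors n - {\<lambda>I. 0})"

text \<open>Polynomial functions on the space of tensors that are homogeneous of the given degree. The
  zero polynomial is homogeneous of every degree.\<close>

inductive hom_poly :: "nat \<Rightarrow> nat \<Rightarrow> (tensor \<Rightarrow> complex) \<Rightarrow> bool" for n where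
  const: "hom_poly n 0 (\<lambda>w. c)"
| coord: "I \<in> multi_indices n \<Longrightarrow> hom_poly n 1 (\<lambda>w. w I)"
| add: "hom_poly n d f \<Longrightarrow> hom_poly n d f' \<Longrightarrow> hom_poly n d (\<lambda>w. f w + f' w)"
| mult: "hom_poly n d f \<Longrightarrow> hom_poly n e f' \<Longrightarrow> hom_poly n (d + e) (\<lambda>w. f w * f' w)"

definition vanishes_on :: "(tensor \<Rightarrow> complex) \<Rightarrow> tensor set set \<Rightarrow> bool" where
  "vanishes_on f S \<longleftrightarrow> (\<forall>P\<in>S. \<forall>w\<in>P. f w = 0)"

definition zariski_closure :: "nat \<Rightarrow> tensor set set \<Rightarrow> tensor set set" where
  "zariski_closure n S = {P \<in> proj_space n.
     \<forall>d f. hom_poly n d f \<and> vanishes_on f S \<longrightarrow> vanishes_on f {P}}"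

text \<open>The rational map is defined where its coordinates do not all vanish.\<close>

definition minors_image :: "nat \<Rightarrow> tensor set set" where
  "minors_image n = {proj_point (minor_vector n A t) | A t.
     A \<in> symmetric_mats n \<and> minor_vector n A t \<noteq> (\<lambda>I. 0)}"

definition minors_variety :: "nat \<Rightarrow> tensor set set" where
  "minors_variety n = zariski_closure n (minors_image n)"

definition proj_cone :: "tensor set set \<Rightarrow> tensor set" where
  "proj_cone S = insert (\<lambda>I. 0) (\<Union>S)"

definition represents_principal_minors :: "nat \<Rightarrow> tensor \<Rightarrow> bool" where
  "represents_principal_minors n w \<longleftrightarrow> w \<in> proj_cone (minors_variety n)"

end

theory Submission
  imports Defs
begin

text \<open>A tensor \<open>w\<close> is read as the multi-affine polynomial $f(y) = \sum_S w_S \prod_{k \in S} y_k$.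
  The principal minors of \<open>A\<close> give $f(y) = \det(1 + \mathrm{diag}(y) A)$.

  Necessity: acting on the minors of \<open>A\<close> by elements of $SL(2)$ with first and second rows
  $(\alpha_k, \beta_k)$ and $(\gamma_k, \delta_k)$ gives, up to the factor $\det N$, the principal minors of $C N^{-1}$
  with $N = \alpha + \beta A$, $C = \gamma + \delta A$; this matrix is symmetric, and the
  hyperdeterminant vanishes on the minors of a symmetric matrix. The case $\det N = 0$ follows
  by deforming \<open>A\<close>, and closure points follow because the condition is polynomial.

  Sufficiency: translate \<open>f\<close> to a generic point close to \<open>0\<close> and normalise $f(0) = 1$.
  For distinct \<open>i\<close>, \<open>j\<close>, the Rayleigh difference $\partial_i f\,\partial_j f - f\,\partial_i\partial_j f$ is then either nonzero at
  \<open>0\<close> or identically zero, and the pairs of the first kind form an equivalence relation. Vanishing of the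
  hyperdeterminants says $\kappa_{ijk}^2 = 4 \Lambda_{ij} \Lambda_{jk} \Lambda_{ik}$ for the third cumulants
  \<open>\<kappa>\<close> and the Rayleigh differences \<open>\<Lambda>\<close> at every point. Off-diagonal entries $a_{ij}$ with
  $a_{ij}^2 = \Lambda_{ij}$ and $\kappa_{ijk} = 2 a_{ij} a_{jk} a_{ik}$ exist because the first-order part of
  the relation in a fourth variable forces the signs to be consistent. All coefficients of higher order
  are determined by those of order at most three, since the top coefficient enters the relations
  linearly to leading order at \<open>0\<close> with a nonzero factor. Hence the translates of \<open>f\<close> are multiples of vectors
  of principal minors, and \<open>w\<close> is a limit of them.\<close>

subsection \<open>Principal minors as determinants of full size\<close>

text \<open>Rows outside \<open>S\<close> are replaced by unit rows, so that all minors are determinants of $n \times n$ matrices.\<close>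

definition pminor :: "nat \<Rightarrow> complex mat \<Rightarrow> nat set \<Rightarrow> complex" where
  "pminor n A S = det (mat n n (\<lambda>(i, j). if i \<in> S then A $$ (i, j) else of_bool (i = j)))"

lemma permutes_less: "p permutes {0..<n} \<Longrightarrow> i < n \<Longrightarrow> p i < (n :: nat)"
  using permutes_in_image[of p "{0..<n}" i] by simp

text \<open>A permutation that moves some index outside \<open>S\<close> picks an off-diagonal zero
  of a unit row, so only the permutations of \<open>S\<close> contribute.\<close>

lemma pminor_Leibniz:
  assumes "S \<subseteq> {..<n}"
  shows "pminor n A S = (\<Sum>p | p permutes S. of_int (sign p) * (\<Prod>i\<in>S. A $$ (i, p i)))"
proof -
  let ?B = "\<lambda>i j. if i \<in> S then A $$ (i, j) else of_bool (i = j)"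
  have prod: "(\<Prod>i<n. ?B i (p i)) = (\<Prod>i\<in>S. A $$ (i, p i))" if "p permutes S" for p
    using assms permutes_not_in[OF that] by (intro prod.mono_neutral_cong_right) auto
  have "(\<Sum>p | p permutes {..<n}. of_int (sign p) * (\<Prod>i<n. ?B i (p i)))
      = (\<Sum>p | p permutes S. of_int (sign p) * (\<Prod>i<n. ?B i (p i)))"
  proof (rule sum.mono_neutral_right)
    show "\<forall>p\<in>{p. p permutes {..<n}} - {p. p permutes S}.
        of_int (sign p) * (\<Prod>i<n. ?B i (p i)) = 0"
    proof
      fix p assume p: "p \<in> {p. p permutes {..<n}} - {p. p permutes S}"
      then obtain i where "i < n" "i \<notin> S" "p i \<noteq> i"
        by (metis (no_types, lifting) Diff_iff lessThan_iff mem_Collect_eq permutes_superset)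
      then have "(\<Prod>i<n. ?B i (p i)) = 0"
        by (intro prod_zero) (auto intro!: bexI[of _ i])
      then show "of_int (sign p) * (\<Prod>i<n. ?B i (p i)) = 0" by simp
    qed
  qed (use assms permutes_subset in \<open>auto simp: finite_permutations\<close>)
  moreover have "pminor n A S = (\<Sum>p | p permutes {..<n}. of_int (sign p) * (\<Prod>i<n. ?B i (p i)))"
    unfolding pminor_def det_def'[OF mat_carrier]
    by (intro sum.cong arg_cong2[where f = "(*)"] prod.cong)
      (auto simp: atLeast0LessThan permutes_less)
  ultimately show ?thesis using prod by simp
qed

text \<open>The enumeration \<open>pick S\<close> transports permutations of the positions below
  \<open>card S\<close> to permutations of \<open>S\<close> with the same sign, which matches the
  two Leibniz expansions term by term.\<close>

lemma det_submatrix_eq_pminor: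
  assumes "A \<in> carrier_mat n n" "S \<subseteq> {..<n}"
  shows "det (submatrix A S S) = pminor n A S"
proof -
  let ?m = "card S" and ?f = "pick S"
  have fin: "finite S" using assms(2) finite_subset by blast
  have eq: "{i. i < n \<and> i \<in> S} = S" using assms(2) by auto
  have in_S: "i < ?m \<Longrightarrow> ?f i \<in> S" for i by (simp add: pick_in_set_le)
  have bij: "bij_betw ?f {0..<?m} S"
    unfolding bij_betw_def
  proof
    show inj: "inj_on ?f {0..<?m}"
      by (rule inj_on_inverseI[where g = "\<lambda>x. card {a \<in> S. a < x}"]) (simp add: card_pick_le)
    show "?f ` {0..<?m} = S"
      using in_S inj fin by (intro card_subset_eq) (auto simp: card_image)
  qed
  let ?M = "map_permutation {0..<?m} ?f"
  have inj: "inj_on ?f {0..<?m}" using bij by (simp add: bij_betw_def)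
  have bijM: "bij_betw ?M {p. p permutes {0..<?m}} {p. p permutes S}"
  proof (rule bij_betw_byWitness[where f' = "map_permutation S (inv_into {0..<?m} ?f)"])
    have inv: "bij_betw (inv_into {0..<?m} ?f) S {0..<?m}" by (rule bij_betw_inv_into[OF bij])
    show "\<forall>p\<in>{p. p permutes {0..<?m}}. map_permutation S (inv_into {0..<?m} ?f) (?M p) = p"
      using map_permutation_compose_inv[OF bij] inj by auto
    show "\<forall>p\<in>{p. p permutes S}. ?M (map_permutation S (inv_into {0..<?m} ?f) p) = p"
      using map_permutation_compose_inv[OF inv] bij_betw_inv_into_right[OF bij] by auto
    show "?M ` {p. p permutes {0..<?m}} \<subseteq> {p. p permutes S}"
      using map_permutation_permutes[OF bij] by auto
    show "map_permutation S (inv_into {0..<?m} ?f) ` {p. p permutes S} \<subseteq> {p. p permutes {0..<?m}}"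
      using map_permutation_permutes[OF inv] by auto
  qed
  have carr: "submatrix A S S \<in> carrier_mat ?m ?m"
    using assms(1) dim_submatrix[of A S S] eq by auto
  have "det (submatrix A S S)
      = (\<Sum>p | p permutes {0..<?m}. of_int (sign p) * (\<Prod>i=0..<?m. A $$ (?f i, ?f (p i))))"
    unfolding det_def'[OF carr] using assms(1) eq
    by (intro sum.cong arg_cong2[where f = "(*)"] prod.cong) (auto simp: submatrix_index permutes_less)
  also have "\<dots> = (\<Sum>p | p permutes {0..<?m}. of_int (sign (?M p)) * (\<Prod>i\<in>S. A $$ (i, ?M p i)))"
    using inj
    by (intro sum.cong arg_cong2[where f = "(*)"])
      (auto simp: sign_map_permutation map_permutation_apply prod.reindex_bij_betw[OF bij, symmetric])
  also have "\<dots> = (\<Sum>p | p permutes S. of_int (sign p) * (\<Prod>i\<in>S. A $$ (i, p i)))"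
    using sum.reindex_bij_betw[OF bijM] by simp
  also have "\<dots> = pminor n A S" using pminor_Leibniz[OF assms(2)] by simp
  finally show ?thesis .
qed

text \<open>Multilinearity in the rows: \<open>S\<close> collects the rows from which the summand
  with \<open>b\<close> is taken. With \<open>a = 1\<close> and \<open>b = y\<close> this is the
  expansion of det(1 + diag(y) A).\<close>

lemma det_diag_plus_scaled_rows:
  fixes A :: "complex mat"
  shows "det (mat n n (\<lambda>(i, j). a i * of_bool (i = j) + b i * A $$ (i, j)))
    = (\<Sum>S\<in>Pow {..<n}. (\<Prod>i\<in>S. b i) * (\<Prod>i\<in>{..<n} - S. a i) * pminor n A S)"
proof -
  let ?P = "{p. p permutes {0..<n}}"
  let ?B = "\<lambda>S i j. if i \<in> S then A $$ (i, j) else of_bool (i = j)"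
  have split: "(\<Prod>i<n. a i * of_bool (i = p i) + b i * A $$ (i, p i))
      = (\<Sum>S\<in>Pow {..<n}. (\<Prod>i\<in>S. b i) * (\<Prod>i\<in>{..<n} - S. a i) * (\<Prod>i<n. ?B S i (p i)))"
    for p
  proof -
    have "(\<Prod>i<n. a i * of_bool (i = p i) + b i * A $$ (i, p i))
        = (\<Prod>i<n. b i * A $$ (i, p i) + a i * of_bool (i = p i))"
      by (simp add: add.commute)
    also have "\<dots> = (\<Sum>S\<in>Pow {..<n}. (\<Prod>i\<in>S. b i * A $$ (i, p i)) * (\<Prod>i\<in>{..<n} - S. a i * of_bool (i = p i)))"
      by (rule prod_add) simp
    also have "\<dots> = (\<Sum>S\<in>Pow {..<n}. (\<Prod>i\<in>S. b i) * (\<Prod>i\<in>{..<n} - S. a i) * (\<Prod>i<n. ?B S i (p i)))"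
    proof (rule sum.cong)
      fix S assume "S \<in> Pow {..<n}"
      then have *: "{..<n} = S \<union> ({..<n} - S)" and fin: "finite S" 
        using finite_subset by auto
      have "(\<Prod>i<n. ?B S i (p i)) = (\<Prod>i\<in>S. A $$ (i, p i)) * (\<Prod>i\<in>{..<n} - S. of_bool (i = p i))"
        using fin by (subst *, subst prod.union_disjoint) auto
      then show "(\<Prod>i\<in>S. b i * A $$ (i, p i)) * (\<Prod>i\<in>{..<n} - S. a i * of_bool (i = p i))
          = (\<Prod>i\<in>S. b i) * (\<Prod>i\<in>{..<n} - S. a i) * (\<Prod>i<n. ?B S i (p i))"
        by (simp add: prod.distrib)
    qed simp
    finally show ?thesis .
  qed
  have "det (mat n n (\<lambda>(i, j). a i * of_bool (i = j) + b i * A $$ (i, j)))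
      = (\<Sum>p\<in>?P. of_int (sign p) * (\<Prod>i<n. a i * of_bool (i = p i) + b i * A $$ (i, p i)))"
    unfolding det_def'[OF mat_carrier]
    by (intro sum.cong arg_cong2[where f = "(*)"] prod.cong)
      (auto simp: atLeast0LessThan permutes_less)
  also have "\<dots> = (\<Sum>S\<in>Pow {..<n}. \<Sum>p\<in>?P. (\<Prod>i\<in>S. b i) * (\<Prod>i\<in>{..<n} - S. a i) * (of_int (sign p) * (\<Prod>i<n. ?B S i (p i))))"
    unfolding split sum_distrib_left by (subst sum.swap) (simp add: mult_ac)
  also have "\<dots> = (\<Sum>S\<in>Pow {..<n}. (\<Prod>i\<in>S. b i) * (\<Prod>i\<in>{..<n} - S. a i) * (\<Sum>p\<in>?P. of_int (sign p) * (\<Prod>i<n. ?B S i (p i))))"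
    by (simp only: sum_distrib_left)
  also have "\<dots> = (\<Sum>S\<in>Pow {..<n}. (\<Prod>i\<in>S. b i) * (\<Prod>i\<in>{..<n} - S. a i) * pminor n A S)"
    unfolding pminor_def det_def'[OF mat_carrier]
    by (intro sum.cong arg_cong2[where f = "(*)"] prod.cong)
      (auto simp: atLeast0LessThan permutes_less)
  finally show ?thesis .
qed

text \<open>The matrix of \<open>S \<union> T\<close> is the product of those of \<open>S\<close>
  and \<open>T\<close>: a row of \<open>A\<close> in \<open>S\<close> lives on the columns in
  \<open>C\<close>, and there the right factor has unit rows.\<close>

lemma pminor_Un_block:
  assumes A: "\<And>i j. i < n \<Longrightarrow> j < n \<Longrightarrow> i \<in> C \<Longrightarrow> j \<notin> C \<Longrightarrow> A $$ (i, j) = 0"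
    and "S \<subseteq> C" "T \<inter> C = {}"
  shows "pminor n A (S \<union> T) = pminor n A S * pminor n A T"
proof -
  let ?B = "\<lambda>S. mat n n (\<lambda>(i, j). if i \<in> S then A $$ (i, j) else of_bool (i = j))"
  have "?B (S \<union> T) = ?B S * ?B T"
  proof (rule eq_matI)
    fix i j assume ij: "i < dim_row (?B S * ?B T)" "j < dim_col (?B S * ?B T)"
    then have ij: "i < n" "j < n" by auto
    have "(?B S * ?B T) $$ (i, j) = (\<Sum>k<n. ?B S $$ (i, k) * ?B T $$ (k, j))"
      using ij by (simp add: scalar_prod_def atLeast0LessThan)
    also have "\<dots> = (if i \<in> S then A $$ (i, j) else ?B T $$ (i, j))"
    proof (cases "i \<in> S")
      case True
      have "(\<Sum>k<n. ?B S $$ (i, k) * ?B T $$ (k, j)) = (\<Sum>k<n. A $$ (i, k) * of_bool (k = j))"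
        using True assms ij by (intro sum.cong) auto
      then show ?thesis using True ij by (simp add: of_bool_def sum.delta if_distrib cong: if_cong)
    next
      case False
      have "(\<Sum>k<n. ?B S $$ (i, k) * ?B T $$ (k, j)) = (\<Sum>k<n. if k = i then ?B T $$ (k, j) else 0)"
        using False ij by (intro sum.cong) auto
      then show ?thesis using False ij by simp
    qed
    also have "\<dots> = ?B (S \<union> T) $$ (i, j)" using ij by auto
    finally show "?B (S \<union> T) $$ (i, j) = (?B S * ?B T) $$ (i, j)" by simp
  qed auto
  then show ?thesis unfolding pminor_def by (simp only: det_mult[OF mat_carrier mat_carrier])
qed

lemma pminor_empty: "pminor n A {} = 1"
  by (simp add: pminor_Leibniz sign_id)

lemma pminor_1: "i < n \<Longrightarrow> pminor n A {i} = A $$ (i, i)"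
  by (simp add: pminor_Leibniz sign_id)

lemma pminor_2:
  assumes "i < n" "j < n" "i \<noteq> j"
  shows "pminor n A {i, j} = A $$ (i, i) * A $$ (j, j) - A $$ (i, j) * A $$ (j, i)"
proof -
  have *: "{i, j} \<subseteq> {..<n}" "finite {j}" "i \<notin> {j}" using assms by auto
  show ?thesis unfolding pminor_Leibniz[OF *(1)] sum_over_permutations_insert[OF *(2,3)]
    using assms by (simp add: sign_swap_id sign_id transpose_def)
qed

lemma pminor_3:
  assumes "i < n" "j < n" "k < n" "i \<noteq> j" "i \<noteq> k" "j \<noteq> k"
  shows "pminor n A {i, j, k} = A $$ (i, i) * A $$ (j, j) * A $$ (k, k)
        - A $$ (i, i) * A $$ (j, k) * A $$ (k, j) - A $$ (j, j) * A $$ (i, k) * A $$ (k, i)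
        - A $$ (k, k) * A $$ (i, j) * A $$ (j, i)
        + A $$ (i, j) * A $$ (j, k) * A $$ (k, i) + A $$ (i, k) * A $$ (k, j) * A $$ (j, i)"
proof -
  have *: "{i, j, k} \<subseteq> {..<n}" "finite {j, k}" "i \<notin> {j, k}" "finite {k}" "j \<notin> {k}" using assms by auto
  show ?thesis unfolding pminor_Leibniz[OF *(1)] sum_over_permutations_insert[OF *(2,3)]
    sum_over_permutations_insert[OF *(4,5)]
    using assms by (simp add: sign_compose sign_swap_id sign_id transpose_def permutation_swap_id)
qed

subsection \<open>Cayley's hyperdeterminant on three indices\<close>

definition cayley :: "complex \<Rightarrow> complex \<Rightarrow> complex \<Rightarrow> complex \<Rightarrow> complex \<Rightarrow> complex \<Rightarrow> complex \<Rightarrow> complex \<Rightarrow> complex" where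
  "cayley u ui uj uk ujk uik uij uijk =
     u\<^sup>2 * uijk\<^sup>2 + ui\<^sup>2 * ujk\<^sup>2 + uj\<^sup>2 * uik\<^sup>2 + uk\<^sup>2 * uij\<^sup>2
   - 2 * u * ui * ujk * uijk - 2 * u * uj * uik * uijk - 2 * u * uk * uij * uijk
   - 2 * ui * uj * ujk * uik - 2 * ui * uk * ujk * uij - 2 * uj * uk * uik * uij
   + 4 * u * ujk * uik * uij + 4 * uk * uj * ui * uijk"

text \<open>Coordinates are indexed by the set of positions with entry 1, and the three positions
  are arbitrary, so that a permutation of the tensor factors only changes \<open>i\<close>,
  \<open>j\<close>, \<open>k\<close>.\<close>

definition hdet3 :: "(nat set \<Rightarrow> complex) \<Rightarrow> nat \<Rightarrow> nat \<Rightarrow> nat \<Rightarrow> complex" where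
  "hdet3 u i j k = cayley (u {}) (u {i}) (u {j}) (u {k}) (u {j, k}) (u {i, k}) (u {i, j}) (u {i, j, k})"

lemma cayley_scale:
  "cayley (c * u) (c * ui) (c * uj) (c * uk) (c * ujk) (c * uik) (c * uij) (c * uijk)
    = c ^ 4 * cayley u ui uj uk ujk uik uij uijk"
  unfolding cayley_def by (simp add: power2_eq_square power4_eq_xxxx algebra_simps)

lemma hdet3_scale: "hdet3 (\<lambda>T. c * u T) i j k = c ^ 4 * hdet3 u i j k"
  unfolding hdet3_def by (rule cayley_scale)

text \<open>The arguments are the principal minors of the symmetric 3 x 3 matrix with diagonal
  \<open>a\<close>, \<open>b\<close>, \<open>c\<close> and off-diagonal entries \<open>x\<close>,
  \<open>y\<close>, \<open>z\<close> in positions 12, 13, 23.\<close>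

lemma cayley_symmetric_minors:
  "cayley 1 a b c (b * c - z * z) (a * c - y * y) (a * b - x * x)
    (a * b * c - a * z * z - b * y * y - c * x * x + x * z * y + y * z * x) = 0"
  unfolding cayley_def by (simp add: power2_eq_square power4_eq_xxxx algebra_simps)

lemma hdet3_pminor:
  assumes sym: "\<And>i j. i < n \<Longrightarrow> j < n \<Longrightarrow> A $$ (i, j) = A $$ (j, i)"
    and "i < n" "j < n" "k < n" "i \<noteq> j" "i \<noteq> k" "j \<noteq> k"
  shows "hdet3 (pminor n A) i j k = 0"
proof -
  have *: "A $$ (j, i) = A $$ (i, j)" "A $$ (k, i) = A $$ (i, k)" "A $$ (k, j) = A $$ (j, k)"
    using assms by auto
  show ?thesis
    unfolding hdet3_def pminor_empty pminor_1[OF assms(2)] pminor_1[OF assms(3)] pminor_1[OF assms(4)]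
      pminor_2[OF assms(2,3,5)] pminor_2[OF assms(2,4,6)] pminor_2[OF assms(3,4,7)]
      pminor_3[OF assms(2-7)] *
    by (rule cayley_symmetric_minors)
qed

section \<open>Functions depending polynomially on one complex parameter\<close>

definition polynomial_fun :: "(complex \<Rightarrow> complex) \<Rightarrow> bool" where
  "polynomial_fun f \<longleftrightarrow> (\<exists>p. \<forall>s. f s = poly p s)"

lemma polynomial_fun_const [simp]: "polynomial_fun (\<lambda>s. c)"
  unfolding polynomial_fun_def by (rule exI[of _ "[:c:]"]) simp

lemma polynomial_fun_ident [simp]: "polynomial_fun (\<lambda>s. s)"
  unfolding polynomial_fun_def by (rule exI[of _ "[:0, 1:]"]) simp

lemma polynomial_fun_add:
  "polynomial_fun f \<Longrightarrow> polynomial_fun g \<Longrightarrow> polynomial_fun (\<lambda>s. f s + g s)"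
  unfolding polynomial_fun_def by (metis poly_add)

lemma polynomial_fun_mult:
  "polynomial_fun f \<Longrightarrow> polynomial_fun g \<Longrightarrow> polynomial_fun (\<lambda>s. f s * g s)"
  unfolding polynomial_fun_def by (metis poly_mult)

lemma polynomial_fun_diff:
  "polynomial_fun f \<Longrightarrow> polynomial_fun g \<Longrightarrow> polynomial_fun (\<lambda>s. f s - g s)"
  unfolding polynomial_fun_def by (metis poly_diff)

lemma polynomial_fun_power: "polynomial_fun f \<Longrightarrow> polynomial_fun (\<lambda>s. f s ^ m)"
  by (induction m) (auto intro: polynomial_fun_mult)

lemma polynomial_fun_sum:
  "(\<And>x. x \<in> X \<Longrightarrow> polynomial_fun (f x)) \<Longrightarrow> polynomial_fun (\<lambda>s. \<Sum>x\<in>X. f x s)"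
  by (induction X rule: infinite_finite_induct) (auto intro: polynomial_fun_add)

lemma polynomial_fun_prod:
  "(\<And>x. x \<in> X \<Longrightarrow> polynomial_fun (f x)) \<Longrightarrow> polynomial_fun (\<lambda>s. \<Prod>x\<in>X. f x s)"
  by (induction X rule: infinite_finite_induct) (auto intro: polynomial_fun_mult)

lemmas polynomial_fun_intros = polynomial_fun_add polynomial_fun_mult polynomial_fun_diff
  polynomial_fun_power polynomial_fun_sum polynomial_fun_prod

lemma polynomial_fun_det:
  assumes "\<And>i j. i < n \<Longrightarrow> j < n \<Longrightarrow> polynomial_fun (\<lambda>s. f s i j)"
  shows "polynomial_fun (\<lambda>s. det (mat n n (\<lambda>(i, j). f s i j)))"
  unfolding det_def'[OF mat_carrier]
  by (intro polynomial_fun_intros polynomial_fun_const) (auto simp: permutes_less intro: assms)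

lemma polynomial_fun_hdet3:
  "(\<And>T. T \<subseteq> {i, j, k} \<Longrightarrow> polynomial_fun (\<lambda>s. u s T)) \<Longrightarrow> polynomial_fun (\<lambda>s. hdet3 (u s) i j k)"
  unfolding hdet3_def cayley_def by (intro polynomial_fun_intros polynomial_fun_const) auto

text \<open>A nonzero polynomial has finitely many roots, so one nonzero value anywhere keeps it
  nonzero on a punctured neighbourhood of every point.\<close>

lemma polynomial_fun_eventually_nonzero:
  assumes "polynomial_fun f" "f s1 \<noteq> 0"
  shows "eventually (\<lambda>s. f s \<noteq> 0) (at s0)"
proof -
  obtain p where p: "\<And>s. f s = poly p s" using assms(1) by (auto simp: polynomial_fun_def)
  then have "p \<noteq> 0" using assms(2) by auto
  then have "finite ({s. poly p s = 0} - {s0})" by (simp add: poly_roots_finite)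
  then have "open (- ({s. poly p s = 0} - {s0}))" (is "open ?U")
    by (rule finite_imp_closed[THEN open_Compl])
  then have "eventually (\<lambda>s. s \<in> ?U) (nhds s0)" by (rule eventually_nhds_in_open) simp
  then show ?thesis unfolding eventually_at_filter p by eventually_elim auto
qed

lemma polynomial_fun_eq_0:
  assumes "polynomial_fun f" "eventually (\<lambda>s. f s = 0) (at s0)"
  shows "f s = 0"
proof (rule ccontr)
  assume "f s \<noteq> 0"
  from polynomial_fun_eventually_nonzero[OF assms(1) this, of s0] assms(2)
  have "eventually (\<lambda>s. False) (at s0)" by eventually_elim simp
  then show False by simp
qed

section \<open>Invariance of the hyperdeterminant condition on symmetric minors\<close>

text \<open>The columns of \<open>N\<close> stacked on \<open>C\<close> span an isotropic subspace,
  because all the row transformations scale the symplectic form by the same \<open>\<tau>\<close>.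
  Hence \<open>M = C * B\<close>, with \<open>B\<close> the inverse of \<open>N\<close>, is
  symmetric, and \<open>R T\<close> is \<open>N\<close> multiplied from the left by the matrix that
  defines the minor of \<open>M\<close> on \<open>T\<close>.\<close>

lemma hdet3_lagrangian_nonsingular:
  fixes A :: "complex mat" and \<alpha> \<beta> \<gamma> \<delta> :: "nat \<Rightarrow> complex" and n :: nat
  defines "R \<equiv> \<lambda>T. mat n n (\<lambda>(r, c). if r \<in> T then \<gamma> r * of_bool (r = c) + \<delta> r * A $$ (r, c)
      else \<alpha> r * of_bool (r = c) + \<beta> r * A $$ (r, c))"
  assumes sym: "\<And>i j. i < n \<Longrightarrow> j < n \<Longrightarrow> A $$ (i, j) = A $$ (j, i)"
    and det: "\<And>r. r < n \<Longrightarrow> \<alpha> r * \<delta> r - \<beta> r * \<gamma> r = \<tau>"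
    and ijk: "i < n" "j < n" "k < n" "i \<noteq> j" "i \<noteq> k" "j \<noteq> k"
    and nz: "det (R {}) \<noteq> 0"
  shows "hdet3 (\<lambda>T. det (R T)) i j k = 0"
proof -
  define N where "N = R {}"
  define C where "C = R {..<n}"
  have N: "N \<in> carrier_mat n n" and C: "C \<in> carrier_mat n n" by (auto simp: N_def C_def R_def)
  obtain B where B: "B \<in> carrier_mat n n" and BN: "B * N = 1\<^sub>m n" and NB: "N * B = 1\<^sub>m n"
    using det_non_zero_imp_unit[OF N] nz unfolding N_def[symmetric] Units_def
    by (auto simp: ring_mat_def)
  \<comment> \<open>Isotropy: row \<open>k\<close> contributes \<open>\<tau>\<close> times a
    difference of entries of \<open>A\<close>, and the total cancels by the symmetry of
    \<open>A\<close>.\<close>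
  have CN: "transpose_mat C * N = transpose_mat N * C"
  proof (rule eq_matI)
    fix r c assume "r < dim_row (transpose_mat N * C)" "c < dim_col (transpose_mat N * C)"
    then have rc: "r < n" "c < n" using N C by auto
    have "(transpose_mat C * N) $$ (r, c) - (transpose_mat N * C) $$ (r, c)
        = (\<Sum>k<n. C $$ (k, r) * N $$ (k, c) - N $$ (k, r) * C $$ (k, c))"
      using rc N C by (simp add: scalar_prod_def atLeast0LessThan sum_subtractf)
    also have "\<dots> = (\<Sum>k<n. \<tau> * ((if k = c then A $$ (k, r) else 0) - (if k = r then A $$ (k, c) else 0)))"
    proof (rule sum.cong)
      fix k assume "k \<in> {..<n}"
      then have k: "k < n" by simp
      show "C $$ (k, r) * N $$ (k, c) - N $$ (k, r) * C $$ (k, c)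
          = \<tau> * ((if k = c then A $$ (k, r) else 0) - (if k = r then A $$ (k, c) else 0))"
        using k rc by (simp add: C_def N_def R_def det[OF k, symmetric] algebra_simps)
    qed simp
    also have "\<dots> = \<tau> * (A $$ (c, r) - A $$ (r, c))"
      using rc by (simp add: sum_distrib_left[symmetric] sum_subtractf)
    also have "\<dots> = 0" using sym rc by simp
    finally show "(transpose_mat C * N) $$ (r, c) = (transpose_mat N * C) $$ (r, c)" by simp
  qed (use N C in auto)
  define M where "M = C * B"
  have M: "M \<in> carrier_mat n n" using C B by (simp add: M_def)
  have "transpose_mat M = transpose_mat B * transpose_mat C"
    unfolding M_def by (rule transpose_mult[OF C B])
  also have "\<dots> = transpose_mat B * transpose_mat C * (N * B)"
    using B C by (simp add: NB)
  also have "\<dots> = transpose_mat B * (transpose_mat C * N) * B"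
    using B C N by (simp add: assoc_mult_mat[of _ n n _ n _ n])
  also have "\<dots> = (transpose_mat B * transpose_mat N) * (C * B)"
    unfolding CN using B C N by (simp add: assoc_mult_mat[of _ n n _ n _ n])
  also have "\<dots> = transpose_mat (N * B) * M" 
    by (simp add: transpose_mult[OF N B] M_def)
  also have "\<dots> = M" using M by (simp add: NB)
  finally have M_sym: "transpose_mat M = M" .
  have sym': "M $$ (r, c) = M $$ (c, r)" if "r < n" "c < n" for r c
    using that M by (metis M_sym carrier_matD index_transpose_mat(1))
  have MN: "M * N = C" using B C N by (simp add: M_def assoc_mult_mat[of _ n n _ n _ n] BN)
  have "det (R T) = det N * pminor n M T" for T
  proof -
    let ?Q = "mat n n (\<lambda>(i, j). if i \<in> T then M $$ (i, j) else of_bool (i = j))"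
    have "R T = ?Q * N"
    proof (rule eq_matI)
      fix r c assume "r < dim_row (?Q * N)" "c < dim_col (?Q * N)"
      then have rc: "r < n" "c < n" using N by auto
      have "(?Q * N) $$ (r, c) = (\<Sum>k<n. ?Q $$ (r, k) * N $$ (k, c))"
        using rc N by (simp add: scalar_prod_def atLeast0LessThan)
      also have "\<dots> = (if r \<in> T then (M * N) $$ (r, c) else N $$ (r, c))"
      proof (cases "r \<in> T")
        case True
        then show ?thesis using rc N M by (simp add: scalar_prod_def atLeast0LessThan)
      next
        case False
        have "(\<Sum>k<n. ?Q $$ (r, k) * N $$ (k, c)) = (\<Sum>k<n. if k = r then N $$ (k, c) else 0)"
          using False rc by (intro sum.cong) auto
        then show ?thesis using False rc by simp
      qed
      also have "\<dots> = R T $$ (r, c)" unfolding MN using rc by (auto simp: C_def N_def R_def)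
      finally show "R T $$ (r, c) = (?Q * N) $$ (r, c)" by simp
    qed (use N in \<open>auto simp: R_def\<close>)
    then show ?thesis unfolding pminor_def using N by (simp add: det_mult[of _ n])
  qed
  then show ?thesis using hdet3_pminor[of n M, OF sym' ijk] by (simp add: hdet3_scale)
qed

text \<open>A linear deformation reaches the nonsingular case: the hyperdeterminant is polynomial in
  \<open>s\<close> and vanishes for small nonzero \<open>s\<close>, hence also at
  \<open>s = 0\<close>.\<close>

lemma hdet3_lagrangian:
  fixes A :: "complex mat"
  assumes sym: "\<And>i j. i < n \<Longrightarrow> j < n \<Longrightarrow> A $$ (i, j) = A $$ (j, i)"
    and det: "\<And>r. r < n \<Longrightarrow> \<alpha> r * \<delta> r - \<beta> r * \<gamma> r = 1"
    and ijk: "i < n" "j < n" "k < n" "i \<noteq> j" "i \<noteq> k" "j \<noteq> k"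
  shows "hdet3 (\<lambda>T. det (mat n n (\<lambda>(r, c). (if r \<in> T then \<gamma> r else \<alpha> r) * t * of_bool (r = c)
      + (if r \<in> T then \<delta> r else \<beta> r) * A $$ (r, c)))) i j k = 0"
proof -
  \<comment> \<open>\<open>c\<close> is chosen so that no \<open>\<alpha> r + \<beta> r * c\<close>
    is zero; where \<open>\<beta> r = 0\<close>, the determinant condition already makes
    \<open>\<alpha> r\<close> nonzero.\<close>
  have "finite ((\<lambda>r. - \<alpha> r / \<beta> r) ` {..<n})" by simp
  then obtain c where c: "c \<notin> (\<lambda>r. - \<alpha> r / \<beta> r) ` {..<n}"
    using ex_new_if_finite[OF infinite_UNIV_char_0] by blast
  have nz: "\<alpha> r + \<beta> r * c \<noteq> 0" if "r < n" for r
  proof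
    assume 0: "\<alpha> r + \<beta> r * c = 0"
    show False
    proof (cases "\<beta> r = 0")
      case True
      then show False using 0 det[OF that] by simp
    next
      case False
      then have "c = - \<alpha> r / \<beta> r" using 0 by (simp add: field_simps eq_neg_iff_add_eq_0 add.commute)
      then show False using c that by blast
    qed
  qed
  \<comment> \<open>The line from \<open>(A, t)\<close> at \<open>s = 0\<close> to the scalar matrix
    \<open>c\<close> with parameter 1 at \<open>s = 1\<close>, where the matrix for the empty set is
    diagonal and invertible.\<close>
  define As where "As s = mat n n (\<lambda>(i, j). (1 - s) * A $$ (i, j) + s * c * of_bool (i = j))" for s
  define ts where "ts s = (1 - s) * t + s" for s
  define R where "R s T = mat n n (\<lambda>(p, q). (if p \<in> T then \<gamma> p else \<alpha> p) * ts s * of_bool (p = q)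
      + (if p \<in> T then \<delta> p else \<beta> p) * ((1 - s) * A $$ (p, q) + s * c * of_bool (p = q)))" for s T
  have poly: "polynomial_fun (\<lambda>s. det (R s T))" for T
    unfolding R_def ts_def
    by (intro polynomial_fun_det polynomial_fun_intros polynomial_fun_const polynomial_fun_ident)
  have "det (R 1 {}) = (\<Prod>r<n. \<alpha> r + \<beta> r * c)"
    unfolding R_def
    by (subst det_upper_triangular[of _ n]) (auto simp: prod_list_diag_prod ts_def atLeast0LessThan)
  then have "det (R 1 {}) \<noteq> 0" using nz by simp
  then have "eventually (\<lambda>s. det (R s {}) \<noteq> 0) (at 0)"
    by (rule polynomial_fun_eventually_nonzero[OF poly])
  then have ev: "eventually (\<lambda>s. hdet3 (\<lambda>T. det (R s T)) i j k = 0) (at 0)"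
  proof eventually_elim
    case (elim s)
    have eq: "R s T = mat n n (\<lambda>(p, q). if p \<in> T then (\<gamma> p * ts s) * of_bool (p = q) + \<delta> p * As s $$ (p, q)
      else (\<alpha> p * ts s) * of_bool (p = q) + \<beta> p * As s $$ (p, q))" for T
      unfolding R_def As_def by (intro cong_mat) auto
    show ?case unfolding eq
    proof (rule hdet3_lagrangian_nonsingular[OF _ _ ijk])
      show "\<alpha> r * ts s * \<delta> r - \<beta> r * (\<gamma> r * ts s) = ts s" if "r < n" for r
      proof -
        have "\<alpha> r * ts s * \<delta> r - \<beta> r * (\<gamma> r * ts s) = (\<alpha> r * \<delta> r - \<beta> r * \<gamma> r) * ts s"
          by (simp add: algebra_simps)
        then show ?thesis using det[OF that] by simp
      qed
    qed (use elim sym in \<open>auto simp: eq As_def\<close>)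
  qed
  have "polynomial_fun (\<lambda>s. hdet3 (\<lambda>T. det (R s T)) i j k)"
    by (rule polynomial_fun_hdet3) (rule poly)
  from polynomial_fun_eq_0[OF this ev, of 0] show ?thesis
    by (simp add: R_def ts_def)
qed

subsection \<open>Partial evaluation of multi-affine polynomials\<close>

text \<open>With $f = \sum_S u_S \prod_{k \in S} x_k$ and \<open>T\<close> disjoint from \<open>R\<close>, this is the coefficient
  of $\prod_{k \in T} x_k$ in $f(y + x)$ for \<open>y\<close> supported in \<open>R\<close>.\<close>

definition slice :: "nat set \<Rightarrow> (nat set \<Rightarrow> complex) \<Rightarrow> (nat \<Rightarrow> complex) \<Rightarrow> nat set \<Rightarrow> complex" where
  "slice R u y T = (\<Sum>S\<in>Pow R. (\<Prod>k\<in>S. y k) * u (S \<union> T))"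

lemma slice_empty [simp]: "slice {} u y = u"
  by (simp add: slice_def fun_eq_iff)

lemma slice_insert:
  assumes "finite R" "r \<notin> R"
  shows "slice (insert r R) u y T = slice R u y T + y r * slice R u y (insert r T)"
proof -
  have inj: "inj_on (insert r) (Pow R)" using assms(2) by (auto simp: inj_on_def)
  have "slice (insert r R) u y T
      = slice R u y T + (\<Sum>S\<in>insert r ` Pow R. (\<Prod>k\<in>S. y k) * u (S \<union> T))"
    unfolding slice_def Pow_insert using assms by (subst sum.union_disjoint) auto
  also have "(\<Sum>S\<in>insert r ` Pow R. (\<Prod>k\<in>S. y k) * u (S \<union> T))
      = (\<Sum>S\<in>Pow R. y r * ((\<Prod>k\<in>S. y k) * u (S \<union> insert r T)))"
    unfolding sum.reindex[OF inj] comp_def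
  proof (rule sum.cong)
    fix S assume "S \<in> Pow R"
    then have "finite S" "r \<notin> S" using assms finite_subset by auto
    then show "(\<Prod>k\<in>insert r S. y k) * u (insert r S \<union> T)
        = y r * ((\<Prod>k\<in>S. y k) * u (S \<union> insert r T))" by simp
  qed simp
  finally show ?thesis by (simp add: slice_def sum_distrib_left)
qed

lemma slice_cong:
  assumes "\<And>k. k \<in> R \<Longrightarrow> y k = z k"
  shows "slice R u y = slice R u z"
  unfolding slice_def using assms by (intro ext sum.cong arg_cong2[where f = "(*)"] prod.cong) auto

lemma slice_cmult: "slice R (\<lambda>T. c * u T) y T = c * slice R u y T"
  by (simp add: slice_def sum_distrib_left mult_ac)

lemma slice_zero: "finite R \<Longrightarrow> slice R u (\<lambda>_. 0) T = u T"
  by (induction R arbitrary: T rule: finite_induct) (auto simp: slice_insert)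

lemma polynomial_fun_slice:
  "(\<And>k. polynomial_fun (\<lambda>s. y s k)) \<Longrightarrow> polynomial_fun (\<lambda>s. slice R u (y s) T)"
  unfolding slice_def by (intro polynomial_fun_intros polynomial_fun_const)

text \<open>The weights vanish unless \<open>T \<subseteq> S \<subseteq> R \<union> T\<close>.
  Summing over all subsets gives the shape shared with \<open>det_diag_plus_scaled_rows\<close> and
  with the action of SL(2).\<close>

lemma slice_as_sum_Pow:
  assumes "finite N" "R \<subseteq> N" "T \<subseteq> N" "R \<inter> T = {}"
  shows "slice R u y T = (\<Sum>S\<in>Pow N. (\<Prod>i\<in>S. if i \<in> T then 1 else if i \<in> R then y i else 0) *
    (\<Prod>i\<in>N - S. if i \<in> T then 0 else 1) * u S)"
proof -
  let ?h = "\<lambda>S. (\<Prod>i\<in>S. if i \<in> T then 1 else if i \<in> R then y i else 0) * (\<Prod>i\<in>N - S. if i \<in> T then 0 else 1) * u S"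
  have inj: "inj_on (\<lambda>S. S \<union> T) (Pow R)" using assms(4) by (auto simp: inj_on_def)
  have "(\<Sum>S\<in>Pow N. ?h S) = (\<Sum>S\<in>(\<lambda>S. S \<union> T) ` Pow R. ?h S)"
  proof (rule sum.mono_neutral_right)
    show "\<forall>S\<in>Pow N - (\<lambda>S. S \<union> T) ` Pow R. ?h S = 0"
    proof
      fix S assume S: "S \<in> Pow N - (\<lambda>S. S \<union> T) ` Pow R"
      then have fin: "finite S" "finite (N - S)" using assms(1) finite_subset by auto
      have "\<not> (T \<subseteq> S \<and> S \<subseteq> R \<union> T)"
      proof
        assume "T \<subseteq> S \<and> S \<subseteq> R \<union> T"
        then have "S = (S - T) \<union> T" "S - T \<in> Pow R" by auto
        then show False using S by blast
      qed
      then consider i where "i \<in> N - S" "i \<in> T" | i where "i \<in> S" "i \<notin> R" "i \<notin> T"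
        using assms(3) by blast
      then show "?h S = 0"
      proof cases
        case 1
        then have "(\<Prod>i\<in>N - S. if i \<in> T then 0 else 1) = (0 :: complex)"
          using fin by (intro prod_zero) auto
        then show ?thesis by simp
      next
        case 2
        then have "(\<Prod>i\<in>S. if i \<in> T then 1 else if i \<in> R then y i else 0) = 0"
          using fin by (intro prod_zero) auto
        then show ?thesis by simp
      qed
    qed
  qed (use assms in auto)
  also have "\<dots> = (\<Sum>S\<in>Pow R. ?h (S \<union> T))" unfolding sum.reindex[OF inj] comp_def ..
  also have "\<dots> = slice R u y T" unfolding slice_def
  proof (rule sum.cong)
    fix S assume S: "S \<in> Pow R"
    have fin: "finite S" "finite T" using S assms by (meson PowD finite_subset order_trans)+
    have "(\<Prod>i\<in>S \<union> T. if i \<in> T then 1 else if i \<in> R then y i else 0) = (\<Prod>k\<in>S. y k)"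
      using S assms(4) fin by (subst prod.union_disjoint) (auto intro!: prod.cong simp: subset_iff disjoint_iff)
    moreover have "(\<Prod>i\<in>N - (S \<union> T). if i \<in> T then 0 else 1) = (1 :: complex)"
      by (intro prod.neutral) auto
    ultimately show "?h (S \<union> T) = (\<Prod>k\<in>S. y k) * u (S \<union> T)" by simp
  qed simp
  finally show ?thesis by simp
qed

text \<open>With all variables equal to \<open>t\<close>, coefficient families that agree below the
  top differ by a single monomial in \<open>t\<close>.\<close>

lemma slice_top_coefficient:
  assumes "finite R" "\<And>S. S \<subset> R \<Longrightarrow> v (S \<union> T) = g (S \<union> T)"
  shows "slice R v (\<lambda>_. t) T = slice R g (\<lambda>_. t) T + t ^ card R * (v (R \<union> T) - g (R \<union> T))"
proof -
  have *: "slice R u (\<lambda>_. t) T = t ^ card R * u (R \<union> T)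
      + (\<Sum>S\<in>Pow R - {R}. (\<Prod>k\<in>S. t) * u (S \<union> T))" for u
    unfolding slice_def using assms(1) by (subst sum.remove[of _ R]) auto
  have "(\<Sum>S\<in>Pow R - {R}. (\<Prod>k\<in>S. t) * v (S \<union> T)) = (\<Sum>S\<in>Pow R - {R}. (\<Prod>k\<in>S. t) * g (S \<union> T))"
    using assms(2) by (intro sum.cong) auto
  then show ?thesis unfolding * by (simp add: algebra_simps)
qed

text \<open>A product of two polynomials, one in the variables of \<open>C\<close> and one in the
  others, is evaluated factor by factor.\<close>

lemma slice_mult:
  assumes "finite R" "\<And>S. u S = g (S \<inter> C) * h (S - C)"
  shows "slice R u y T = slice (R \<inter> C) g y (T \<inter> C) * slice (R - C) h y (T - C)"
  using assms(1)
proof (induction R arbitrary: T rule: finite_induct)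
  case empty
  then show ?case by (simp add: assms(2)[of T])
next
  case (insert r R)
  show ?case
  proof (cases "r \<in> C")
    case True
    then have "insert r R \<inter> C = insert r (R \<inter> C)" "insert r R - C = R - C"
      "insert r T \<inter> C = insert r (T \<inter> C)" "insert r T - C = T - C" by auto
    then show ?thesis using insert by (simp add: slice_insert algebra_simps)
  next
    case False
    then have "insert r R \<inter> C = R \<inter> C" "insert r R - C = insert r (R - C)"
      "insert r T \<inter> C = T \<inter> C" "insert r T - C = insert r (T - C)" by auto
    then show ?thesis using insert by (simp add: slice_insert algebra_simps)
  qed
qed

text \<open>Rows in \<open>T\<close> lose their unit part because the coefficient linear in those
  variables is taken. The factor \<open>1\<close> stands for the parameter \<open>t\<close> of
  \<open>hdet3_lagrangian\<close>.\<close>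

lemma slice_pminor:
  assumes "R \<subseteq> {..<n}" "T \<subseteq> {..<n}" "R \<inter> T = {}"
  shows "slice R (pminor n A) y T = det (mat n n (\<lambda>(r, c). (if r \<in> T then 0 else 1) * 1 * of_bool (r = c)
      + (if r \<in> T then 1 else if r \<in> R then y r else 0) * A $$ (r, c)))"
  by (subst slice_as_sum_Pow[OF _ assms], simp, subst det_diag_plus_scaled_rows)
    simp

lemma hdet3_cong: "(\<And>T. T \<subseteq> {i, j, k} \<Longrightarrow> u T = u' T) \<Longrightarrow> hdet3 u i j k = hdet3 u' i j k"
  by (simp add: hdet3_def)

lemma hdet3_slice_pminor:
  assumes sym: "\<And>i j. i < n \<Longrightarrow> j < n \<Longrightarrow> A $$ (i, j) = A $$ (j, i)"
    and ijk: "i < n" "j < n" "k < n" "i \<noteq> j" "i \<noteq> k" "j \<noteq> k"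
    and R: "R \<subseteq> {..<n} - {i, j, k}"
  shows "hdet3 (slice R (pminor n A) y) i j k = 0"
proof -
  have "hdet3 (slice R (pminor n A) y) i j k
    = hdet3 (\<lambda>T. det (mat n n (\<lambda>(r, c). (if r \<in> T then 0 else 1) * 1 * of_bool (r = c)
      + (if r \<in> T then 1 else if r \<in> R then y r else 0) * A $$ (r, c)))) i j k"
    using ijk R by (intro hdet3_cong slice_pminor) auto
  also have "\<dots> = 0"
    using sym ijk by (intro hdet3_lagrangian) auto
  finally show ?thesis .
qed

subsection \<open>Rayleigh differences and cumulants\<close>

text \<open>For \<open>v {} = 1\<close> and \<open>i \<noteq> j\<close> this is minus the second
  joint cumulant; for the minors of a symmetric matrix it is the square of the entry
  \<open>(i, j)\<close>.\<close>

definition rayleigh :: "(nat set \<Rightarrow> complex) \<Rightarrow> nat \<Rightarrow> nat \<Rightarrow> complex" where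
  "rayleigh v i j = v {i} * v {j} - v {} * v {i, j}"

definition cumulant3 :: "(nat set \<Rightarrow> complex) \<Rightarrow> nat \<Rightarrow> nat \<Rightarrow> nat \<Rightarrow> complex" where
  "cumulant3 v i j k = v {i, j, k} - v {i} * v {j, k} - v {j} * v {i, k} - v {k} * v {i, j}
    + 2 * v {i} * v {j} * v {k}"

definition cumulant4 :: "(nat set \<Rightarrow> complex) \<Rightarrow> nat \<Rightarrow> nat \<Rightarrow> nat \<Rightarrow> nat \<Rightarrow> complex" where
  "cumulant4 v i j k l = v {i, j, k, l} - v {i} * v {j, k, l} - v {j} * v {i, k, l}
    - v {k} * v {i, j, l} - v {l} * v {i, j, k}
    - v {i, j} * v {k, l} - v {i, k} * v {j, l} - v {i, l} * v {j, k}
    + 2 * (v {i} * v {j} * v {k, l} + v {i} * v {k} * v {j, l} + v {i} * v {l} * v {j, k}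
      + v {j} * v {k} * v {i, l} + v {j} * v {l} * v {i, k} + v {k} * v {l} * v {i, j})
    - 6 * v {i} * v {j} * v {k} * v {l}"

lemma rayleigh_commute: "rayleigh v i j = rayleigh v j i"
  by (simp add: rayleigh_def insert_commute mult.commute)

lemma cumulant3_perm:
  "cumulant3 v i j k = cumulant3 v j i k" "cumulant3 v i j k = cumulant3 v i k j"
  by (simp_all add: cumulant3_def insert_commute)

lemma cumulant4_perm:
  "cumulant4 v i j k l = cumulant4 v i j l k" "cumulant4 v i j k l = cumulant4 v i k j l"
  "cumulant4 v i j k l = cumulant4 v j i k l"
  by (simp_all add: cumulant4_def insert_commute algebra_simps)

text \<open>Lower triangular shears, which preserve the hyperdeterminant, clear \<open>a\<close>,
  \<open>b\<close>, \<open>c\<close> and turn the remaining coordinates into cumulants; only the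
  square of the last one and one term with coefficient 4 survive.\<close>

lemma cayley_normalized:
  "cayley 1 a b c bc ac ab abc = (abc - a * bc - b * ac - c * ab + 2 * a * b * c)\<^sup>2
    - 4 * (a * b - ab) * (b * c - bc) * (a * c - ac)"
  unfolding cayley_def by (simp add: power2_eq_square algebra_simps)

lemma hdet3_normalized:
  assumes "v {} = 1"
  shows "hdet3 v i j k = (cumulant3 v i j k)\<^sup>2 - 4 * rayleigh v i j * rayleigh v j k * rayleigh v i k"
  unfolding hdet3_def cumulant3_def rayleigh_def assms cayley_normalized by simp

text \<open>The conclusion is the coefficient of \<open>t\<close> in the hypothesis, written in terms of cumulants.\<close>

lemma cayley_tangent:
  fixes a b c d ab ac ad bc bd cd abc abd acd bcd abcd :: complex
  assumes "\<And>t. cayley (1 + t * d) (a + t * ad) (b + t * bd) (c + t * cd) (bc + t * bcd)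
    (ac + t * acd) (ab + t * abd) (abc + t * abcd) = 0"
  shows "(abc - a * bc - b * ac - c * ab + 2 * a * b * c)
      * (abcd - a * bcd - b * acd - c * abd - d * abc - ab * cd - ac * bd - ad * bc
        + 2 * (a * b * cd + a * c * bd + a * d * bc + b * c * ad + b * d * ac + c * d * ab)
        - 6 * a * b * c * d)
    = - 2 * ((abd - a * bd - b * ad - d * ab + 2 * a * b * d) * (b * c - bc) * (a * c - ac)
      + (bcd - b * cd - c * bd - d * bc + 2 * b * c * d) * (a * b - ab) * (a * c - ac)
      + (acd - a * cd - c * ad - d * ac + 2 * a * c * d) * (a * b - ab) * (b * c - bc))"
    (is "?L = ?R")
proof -
  let ?f = "\<lambda>t. cayley (1 + t * d) (a + t * ad) (b + t * bd) (c + t * cd) (bc + t * bcd)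
    (ac + t * acd) (ab + t * abd) (abc + t * abcd)"
  \<comment> \<open>The first argument \<open>1 + t * d\<close> does not stay at 1; by homogeneity
    of degree four this adds \<open>4 * d\<close> times the value at \<open>t = 0\<close>.\<close>
  have "(?f has_field_derivative (2 * (?L - ?R) + 4 * d * cayley 1 a b c bc ac ab abc)) (at 0)"
    unfolding cayley_def
    by (rule derivative_eq_intros refl)+ (simp add: power2_eq_square algebra_simps)
  moreover have "(?f has_field_derivative 0) (at 0)" unfolding assms by simp
  ultimately have "2 * (?L - ?R) + 4 * d * cayley 1 a b c bc ac ab abc = 0" by (rule DERIV_unique)
  moreover have "cayley 1 a b c bc ac ab abc = 0" using assms[of 0] by simp
  moreover have "2 * (x - y) + 4 * d * w = 0 \<Longrightarrow> w = 0 \<Longrightarrow> x = y" for x y w by simp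
  ultimately show ?thesis by blast
qed

text \<open>The relation of \<open>hdet3_normalized\<close> is differentiated along the coordinate
  \<open>l\<close>, which adds the index \<open>l\<close> to each cumulant; Rayleigh differences are
  negated second cumulants, whence the sign.\<close>

lemma hdet3_tangent:
  assumes "v {} = 1" "l \<notin> {i, j, k}" "\<And>t. hdet3 (slice {l} v (\<lambda>_. t)) i j k = 0"
  shows "cumulant3 v i j k * cumulant4 v i j k l
    = - 2 * (cumulant3 v i j l * rayleigh v j k * rayleigh v i k
      + cumulant3 v j k l * rayleigh v i j * rayleigh v i k
      + cumulant3 v i k l * rayleigh v i j * rayleigh v j k)"
proof -
  have eq: "slice {l} v (\<lambda>_. t) T = v T + t * v (insert l T)" for t T
    using slice_insert[of "{}" l v "\<lambda>_. t" T] by simp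
  have "cayley (1 + t * v {l}) (v {i} + t * v {i, l}) (v {j} + t * v {j, l}) (v {k} + t * v {k, l})
    (v {j, k} + t * v {j, k, l}) (v {i, k} + t * v {i, k, l}) (v {i, j} + t * v {i, j, l})
    (v {i, j, k} + t * v {i, j, k, l}) = 0" for t
    using assms(3)[of t] unfolding hdet3_def eq assms(1) by (simp add: insert_commute)
  from cayley_tangent[OF this] show ?thesis
    unfolding cumulant3_def cumulant4_def rayleigh_def assms(1) by simp
qed

text \<open>\<open>a\<close>, \<open>b\<close>, \<open>c\<close> are the entries joining a fourth
  point to \<open>i\<close>, \<open>j\<close>, \<open>k\<close>, while \<open>d\<close>,
  \<open>e\<close>, \<open>f\<close> belong to the pairs \<open>ij\<close>, \<open>ik\<close>,
  \<open>jk\<close>, and \<open>z\<close> is the fourth cumulant. With the wrong sign of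
  \<open>K\<close> the four relations become linear equations in \<open>z\<close> and three products
  of entries, whose only solution is zero.\<close>

lemma four_point_sign:
  fixes a b c d e f z K :: complex
  assumes nz: "a \<noteq> 0" "b \<noteq> 0" "c \<noteq> 0" "d \<noteq> 0" "e \<noteq> 0" "f \<noteq> 0"
    and K: "K\<^sup>2 = 4 * d\<^sup>2 * f\<^sup>2 * e\<^sup>2"
    and 4: "2 * a * d * b * z = - 2 * (2 * a * e * c * d\<^sup>2 * b\<^sup>2 + K * a\<^sup>2 * b\<^sup>2 + 2 * b * f * c * a\<^sup>2 * d\<^sup>2)"
    and 3: "2 * a * e * c * z = - 2 * (2 * a * d * b * e\<^sup>2 * c\<^sup>2 + K * a\<^sup>2 * c\<^sup>2 + 2 * c * f * b * a\<^sup>2 * e\<^sup>2)"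
    and 2: "2 * b * f * c * z = - 2 * (2 * b * d * a * f\<^sup>2 * c\<^sup>2 + K * b\<^sup>2 * c\<^sup>2 + 2 * c * e * a * b\<^sup>2 * f\<^sup>2)"
    and 1: "K * z = - 2 * (2 * a * d * b * f\<^sup>2 * e\<^sup>2 + 2 * b * f * c * d\<^sup>2 * e\<^sup>2 + 2 * a * e * c * d\<^sup>2 * f\<^sup>2)"
  shows "K = 2 * d * f * e"
proof (rule ccontr)
  assume "K \<noteq> 2 * d * f * e"
  moreover have "(K - 2 * d * f * e) * (K + 2 * d * f * e) = 0"
    using K by (simp add: power2_eq_square algebra_simps)
  ultimately have K': "K = - 2 * d * f * e" by (simp add: eq_neg_iff_add_eq_0)
  \<comment> \<open>The products of entries along the three 4-cycles on the four points.\<close>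
  define X Y Z where "X = c * e * d * b" and "Y = e * f * b * a" and "Z = c * f * a * d"
  have "(2 * a * d * b) * (z + 2 * (X - Y + Z)) = 0"
    using 4 unfolding K' X_def Y_def Z_def by (simp add: power2_eq_square algebra_simps)
  then have z4: "z + 2 * (X - Y + Z) = 0" using nz by simp
  have "(2 * a * e * c) * (z + 2 * (X - Z + Y)) = 0"
    using 3 unfolding K' X_def Y_def Z_def by (simp add: power2_eq_square algebra_simps)
  then have z3: "z + 2 * (X - Z + Y) = 0" using nz by simp
  have "(2 * b * f * c) * (z + 2 * (Z - X + Y)) = 0"
    using 2 unfolding K' X_def Y_def Z_def by (simp add: power2_eq_square algebra_simps)
  then have z2: "z + 2 * (Z - X + Y) = 0" using nz by simp
  have "(2 * d * f * e) * (z - 2 * (X + Y + Z)) = 0"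
    using 1 unfolding K' X_def Y_def Z_def by (simp add: power2_eq_square algebra_simps)
  then have z1: "z - 2 * (X + Y + Z) = 0" using nz by simp
  have "4 * z = (z - 2 * (X + Y + Z)) + (z + 2 * (Z - X + Y)) + (z + 2 * (X - Z + Y)) + (z + 2 * (X - Y + Z))"
    by (simp add: algebra_simps)
  then have "z = 0" unfolding z1 z2 z3 z4 by simp
  have "4 * X = (z + 2 * (X - Z + Y)) + (z + 2 * (X - Y + Z)) - 2 * z"
    by (simp add: algebra_simps)
  then have "X = 0" unfolding z3 z4 by (simp add: \<open>z = 0\<close>)
  then show False using nz by (simp add: X_def)
qed

subsection \<open>Normalised generic tensors\<close>

text \<open>In the Rayleigh difference the top coefficient occurs only in the slice at
  \<open>{i, j}\<close>, which is multiplied by the slice at \<open>{}\<close>. The latter is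
  nonzero for small \<open>t\<close>.\<close>

lemma rayleigh_slice_determines_top:
  assumes I: "finite I" "i \<in> I" "j \<in> I" "i \<noteq> j" and v: "v {} \<noteq> 0"
    and agree: "\<And>S. S \<subset> I \<Longrightarrow> v S = g S"
    and v0: "\<And>t. rayleigh (slice (I - {i, j}) v (\<lambda>_. t)) i j = 0"
    and g0: "\<And>t. rayleigh (slice (I - {i, j}) g (\<lambda>_. t)) i j = 0"
  shows "v I = g I"
proof -
  let ?R = "I - {i, j}"
  let ?s = "\<lambda>u t. slice ?R u (\<lambda>_. t)"
  have fin: "finite ?R" using I by simp
  have top: "?s v t T = ?s g t T + t ^ card ?R * (v (?R \<union> T) - g (?R \<union> T))" if "T \<subseteq> {i, j}" for t T
    by (rule slice_top_coefficient[OF fin]) (use that I in \<open>intro agree, blast\<close>)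
  have sub: "?s v t T = ?s g t T" if "T \<subset> {i, j}" for t T
  proof -
    have "?R \<union> T \<subset> I" using that I by blast
    then show ?thesis using top[of T t] that agree by simp
  qed
  have ext: "?R \<union> {i, j} = I" using I by auto
  have zero: "?s v t {} * (t ^ card ?R * (v I - g I)) = 0" for t
  proof -
    have low: "?s v t {} = ?s g t {}" "?s v t {i} = ?s g t {i}" "?s v t {j} = ?s g t {j}"
      by (intro sub; use I in auto)+
    have high: "?s v t {i, j} = ?s g t {i, j} + t ^ card ?R * (v I - g I)"
      using top[of "{i, j}" t] unfolding ext by simp
    have "a * b - c * (d + e) = 0 \<Longrightarrow> a * b - c * d = 0 \<Longrightarrow> c * e = 0" for a b c d e :: complex
      by (simp add: algebra_simps)
    from this[OF v0[of t, unfolded rayleigh_def low high] g0[of t, unfolded rayleigh_def]]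
    show ?thesis unfolding low .
  qed
  have "eventually (\<lambda>t. ?s v t {} \<noteq> 0) (at 0)"
    by (rule polynomial_fun_eventually_nonzero[of _ 0])
      (use v fin in \<open>auto simp: slice_zero intro!: polynomial_fun_slice\<close>)
  moreover have "eventually (\<lambda>t. t \<noteq> 0) (at (0 :: complex))"
    by (rule polynomial_fun_eventually_nonzero[of _ 1]) auto
  ultimately have "eventually (\<lambda>t. v I = g I) (at (0 :: complex))"
  proof eventually_elim
    case (elim t)
    then show ?case using zero[of t] by simp
  qed
  then show ?thesis by simp
qed

text \<open>At \<open>u = 1\<close> and \<open>e = 0\<close> the cofactor of \<open>e\<close> is
  twice the third cumulant.\<close>

lemma cayley_linear_difference:
  "cayley u a b c bc ac ab (abc + e) - cayley u a b c bc ac ab abc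
    = e * (u\<^sup>2 * (2 * abc + e) - 2 * u * (a * bc + b * ac + c * ab) + 4 * a * b * c)"
  unfolding cayley_def by (simp add: power2_eq_square algebra_simps)

text \<open>If the top coefficients differed, cancelling their difference times a power of
  \<open>t\<close> would leave a polynomial \<open>h\<close> that vanishes identically. But
  \<open>h 0\<close> is twice the third cumulant of \<open>v\<close>, whose square is four times a
  product of nonzero Rayleigh differences. Since \<open>I \<noteq> {i, j, k}\<close>, the power of
  \<open>t\<close> is positive and the correction inside \<open>h\<close> disappears at 0.\<close>

lemma hdet3_slice_determines_top:
  assumes I: "finite I" "i \<in> I" "j \<in> I" "k \<in> I" and ijk: "i \<noteq> j" "i \<noteq> k" "j \<noteq> k" and "I \<noteq> {i, j, k}"
    and v: "v {} = 1" and agree: "\<And>S. S \<subset> I \<Longrightarrow> v S = g S"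
    and v0: "\<And>t. hdet3 (slice (I - {i, j, k}) v (\<lambda>_. t)) i j k = 0"
    and g0: "\<And>t. hdet3 (slice (I - {i, j, k}) g (\<lambda>_. t)) i j k = 0"
    and nz: "rayleigh v i j \<noteq> 0" "rayleigh v i k \<noteq> 0" "rayleigh v j k \<noteq> 0"
  shows "v I = g I"
proof (rule ccontr)
  let ?R = "I - {i, j, k}"
  let ?s = "\<lambda>u t. slice ?R u (\<lambda>_. t)"
  let ?e = "\<lambda>t. t ^ card ?R * (v I - g I)"
  assume neq: "v I \<noteq> g I"
  have fin: "finite ?R" using I by simp
  have "?R \<noteq> {}" using I assms(8) by auto
  then have card: "card ?R > 0" using fin by (simp add: card_gt_0_iff)
  have top: "?s v t T = ?s g t T + t ^ card ?R * (v (?R \<union> T) - g (?R \<union> T))" if "T \<subseteq> {i, j, k}" for t T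
    by (rule slice_top_coefficient[OF fin]) (use that I in \<open>intro agree, blast\<close>)
  have sub: "?s v t T = ?s g t T" if "T \<subset> {i, j, k}" for t T
  proof -
    have "?R \<union> T \<subset> I" using that I by blast
    then show ?thesis using top[of T t] that agree by simp
  qed
  have ext: "?R \<union> {i, j, k} = I" using I by auto
  define h where "h t = (?s g t {})\<^sup>2 * (2 * ?s g t {i, j, k} + ?e t)
    - 2 * ?s g t {} * (?s g t {i} * ?s g t {j, k} + ?s g t {j} * ?s g t {i, k} + ?s g t {k} * ?s g t {i, j})
    + 4 * ?s g t {i} * ?s g t {j} * ?s g t {k}" for t
  have zero: "?e t * h t = 0" for t
  proof -
    have "?s v t {} = ?s g t {}" "?s v t {i} = ?s g t {i}" "?s v t {j} = ?s g t {j}"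
      "?s v t {k} = ?s g t {k}" "?s v t {j, k} = ?s g t {j, k}" "?s v t {i, k} = ?s g t {i, k}"
      "?s v t {i, j} = ?s g t {i, j}" by (intro sub; use ijk in auto)+
    moreover have "?s v t {i, j, k} = ?s g t {i, j, k} + ?e t"
      using top[of "{i, j, k}" t] unfolding ext by simp
    ultimately show ?thesis
      using v0[of t] g0[of t] cayley_linear_difference[of "?s g t {}" "?s g t {i}" "?s g t {j}"
        "?s g t {k}" "?s g t {j, k}" "?s g t {i, k}" "?s g t {i, j}" "?s g t {i, j, k}" "?e t"]
      unfolding hdet3_def h_def by simp
  qed
  have "eventually (\<lambda>t. t \<noteq> 0) (at (0 :: complex))"
    by (rule polynomial_fun_eventually_nonzero[of _ 1]) auto
  then have ev: "eventually (\<lambda>t. h t = 0) (at 0)"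
  proof eventually_elim
    case (elim t)
    then show ?case using zero[of t] neq by simp
  qed
  have "polynomial_fun h" unfolding h_def
    by (intro polynomial_fun_intros polynomial_fun_slice polynomial_fun_const polynomial_fun_ident)
  from polynomial_fun_eq_0[OF this ev, of 0] have "h 0 = 0" .
  moreover have "g S = v S" if "S \<subseteq> {i, j, k}" for S
  proof -
    have "S \<subset> I" using that I assms(8) by blast
    then show ?thesis using agree by simp
  qed
  ultimately have "2 * cumulant3 v i j k = 0"
    using card fin v by (simp add: h_def slice_zero cumulant3_def zero_power algebra_simps)
  then have "cumulant3 v i j k = 0" by simp
  moreover have "hdet3 v i j k = 0"
  proof -
    have "hdet3 (slice ?R v (\<lambda>_. 0)) i j k = hdet3 v i j k"
      unfolding hdet3_def slice_zero[OF fin] ..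
    then show ?thesis using v0[of 0] by simp
  qed
  ultimately show False using nz hdet3_normalized[of v, OF v] by simp
qed

text \<open>The hypothesis is the vanishing of one Rayleigh difference along the third coordinate
  direction; the conclusion concerns the other two at the base point.\<close>

lemma rank_one_family:
  fixes a b c ab ac bc abc :: complex
  assumes "\<And>t. (a + t * ac) * (b + t * bc) = (1 + t * c) * (ab + t * abc)"
  shows "(a * c - ac) * (b * c - bc) = 0"
proof -
  \<comment> \<open>\<open>P\<close> and \<open>Q\<close> are the coefficients of \<open>t\<close>
    and \<open>t\<^sup>2\<close> in the difference of the two sides; \<open>t = 1\<close> and
    \<open>t = - 1\<close> separate them.\<close>
  define P where "P = a * bc + ac * b - abc - c * (a * b)"
  define Q where "Q = ac * bc - c * abc"
  have ab: "ab = a * b" using assms[of 0] by simp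
  have "P + Q = 0" "Q - P = 0"
    using assms[of 1] assms[of "- 1"] by (simp_all add: P_def Q_def ab algebra_simps)
  then have "P = 0" "Q = 0" by auto
  moreover have "(a * c - ac) * (b * c - bc) = Q - c * P"
    by (simp add: P_def Q_def algebra_simps)
  ultimately show ?thesis by simp
qed

section \<open>Reconstruction of a symmetric matrix from a normalised generic tensor\<close>

text \<open>\<open>generic\<close> is the condition on the base point: each Rayleigh difference is
  nonzero there or identically zero. The Rayleigh difference of \<open>i\<close> and
  \<open>j\<close> is constant in these two variables, so slices over the others cover every
  point.\<close>

locale normalized_tensor =
  fixes n :: nat and v :: "nat set \<Rightarrow> complex"
  assumes empty: "v {} = 1"
    and hdet: "\<And>i j k R y. i < n \<Longrightarrow> j < n \<Longrightarrow> k < n \<Longrightarrow> i \<noteq> j \<Longrightarrow> i \<noteq> k \<Longrightarrow> j \<noteq> k \<Longrightarrow>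
      R \<subseteq> {..<n} - {i, j, k} \<Longrightarrow> hdet3 (slice R v y) i j k = 0"
    and generic: "\<And>i j R y. i < n \<Longrightarrow> j < n \<Longrightarrow> i \<noteq> j \<Longrightarrow> rayleigh v i j = 0 \<Longrightarrow>
      R \<subseteq> {..<n} - {i, j} \<Longrightarrow> rayleigh (slice R v y) i j = 0"
begin

lemma cumulant3_square:
  assumes "i < n" "j < n" "k < n" "i \<noteq> j" "i \<noteq> k" "j \<noteq> k"
  shows "(cumulant3 v i j k)\<^sup>2 = 4 * rayleigh v i j * rayleigh v j k * rayleigh v i k"
  using hdet[OF assms, of "{}"] hdet3_normalized[of v, OF empty] by simp

lemma cumulant3_mult_cumulant4:
  assumes "i < n" "j < n" "k < n" "l < n" "i \<noteq> j" "i \<noteq> k" "j \<noteq> k" "l \<notin> {i, j, k}"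
  shows "cumulant3 v i j k * cumulant4 v i j k l
    = - 2 * (cumulant3 v i j l * rayleigh v j k * rayleigh v i k
      + cumulant3 v j k l * rayleigh v i j * rayleigh v i k
      + cumulant3 v i k l * rayleigh v i j * rayleigh v j k)"
  by (rule hdet3_tangent[where v = v, OF empty assms(8) hdet]) (use assms in auto)

text \<open>If the Rayleigh difference of \<open>i\<close> and \<open>j\<close> vanished at the base
  point, it would vanish along the direction \<open>k\<close>, and \<open>rank_one_family\<close>
  would make one of the other two zero.\<close>

lemma rayleigh_trans:
  assumes "i < n" "j < n" "k < n" "i \<noteq> j" "i \<noteq> k" "j \<noteq> k"
    and "rayleigh v i k \<noteq> 0" "rayleigh v j k \<noteq> 0"
  shows "rayleigh v i j \<noteq> 0"
proof
  assume 0: "rayleigh v i j = 0"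
  have eq: "slice {k} v y T = v T + y k * v (insert k T)" for y T
    using slice_insert[of "{}" k v y T] by simp
  have R: "{k} \<subseteq> {..<n} - {i, j}" using assms by auto
  have f: "(v {i} + t * v {i, k}) * (v {j} + t * v {j, k}) = (1 + t * v {k}) * (v {i, j} + t * v {i, j, k})" for t
    using generic[OF assms(1,2,4) 0 R, of "\<lambda>_. t"] unfolding rayleigh_def eq empty
    by (simp add: insert_commute)
  from rank_one_family[OF this] have "(v {i} * v {k} - v {i, k}) * (v {j} * v {k} - v {j, k}) = 0" .
  then show False using assms by (simp add: rayleigh_def empty)
qed

text \<open>Reflexivity is imposed, since \<open>rayleigh v i i\<close> does not have the meaning of
  a squared entry.\<close>

definition related :: "nat \<Rightarrow> nat \<Rightarrow> bool" where
  "related i j \<longleftrightarrow> i < n \<and> j < n \<and> (i = j \<or> rayleigh v i j \<noteq> 0)"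

lemma related_sym: "related i j \<Longrightarrow> related j i"
  by (auto simp: related_def rayleigh_commute)

lemma related_trans: "related i j \<Longrightarrow> related j k \<Longrightarrow> related i k"
  unfolding related_def using rayleigh_trans[of i k j] by (metis rayleigh_commute)

text \<open>A representative of the class of \<open>i\<close>. Its edges form a spanning star of the
  class, so the square roots on them can be chosen independently.\<close>

definition leader :: "nat \<Rightarrow> nat" where "leader i = (LEAST r. related r i)"

lemma related_leader: "i < n \<Longrightarrow> related (leader i) i"
  unfolding leader_def by (rule LeastI[of _ i]) (simp add: related_def)

lemma leader_cong: "related i j \<Longrightarrow> leader i = leader j"
  unfolding leader_def using related_sym related_trans by metis

text \<open>A symmetric matrix is determined by its principal minors only up to conjugation by diagonal signs; the
  signs are fixed by choosing the square roots in the row of the leader of each class.\<close>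

definition entry :: "nat \<Rightarrow> nat \<Rightarrow> complex" where
  "entry i j = (if i = j then v {i} else if leader i \<noteq> leader j then 0
    else if leader i = i \<or> leader i = j then csqrt (rayleigh v i j)
    else cumulant3 v (leader i) i j / (2 * csqrt (rayleigh v (leader i) i) * csqrt (rayleigh v (leader i) j)))"

lemma entry_sym: "entry i j = entry j i"
proof (cases "leader i = leader j")
  case True
  then show ?thesis
    using cumulant3_perm(2)[of v "leader j" i j] rayleigh_commute[of v i j]
    by (auto simp: entry_def mult_ac)
next
  case False
  then show ?thesis by (simp add: entry_def eq_commute[of i j])
qed

lemma rayleigh_related: "related i j \<Longrightarrow> i \<noteq> j \<Longrightarrow> rayleigh v i j \<noteq> 0"
  by (simp add: related_def)

text \<open>Outside the row and column of the leader this is \<open>cumulant3_square\<close> for the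
  triple with the leader, divided by two nonzero Rayleigh differences.\<close>

lemma entry_square:
  assumes "i < n" "j < n" "i \<noteq> j"
  shows "(entry i j)\<^sup>2 = rayleigh v i j"
proof (cases "leader i = leader j")
  case False
  then have "\<not> related i j" using leader_cong by blast
  then show ?thesis using assms False by (simp add: entry_def related_def)
next
  case True
  show ?thesis
  proof (cases "leader i = i \<or> leader i = j")
    case True
    then show ?thesis using \<open>leader i = leader j\<close> assms by (auto simp: entry_def)
  next
    case False
    let ?r = "leader i"
    have rel: "related ?r i" "related ?r j" using related_leader assms True by metis+
    then have "?r < n" by (simp add: related_def)
    have nz: "rayleigh v ?r i \<noteq> 0" "rayleigh v ?r j \<noteq> 0"
      using rayleigh_related[OF rel(1)] rayleigh_related[OF rel(2)] False by auto
    have "(cumulant3 v ?r i j)\<^sup>2 = 4 * rayleigh v ?r i * rayleigh v i j * rayleigh v ?r j"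
      using False assms \<open>?r < n\<close> by (intro cumulant3_square) auto
    moreover have "entry i j = cumulant3 v ?r i j / (2 * csqrt (rayleigh v ?r i) * csqrt (rayleigh v ?r j))"
      using True False assms by (simp add: entry_def)
    ultimately show ?thesis using nz by (simp add: power_divide power_mult_distrib)
  qed
qed

lemma cumulant3_leader:
  assumes "i < n" "j < n" "i \<noteq> j" "related i j" "leader i \<noteq> i" "leader i \<noteq> j"
  shows "cumulant3 v (leader i) i j = 2 * entry (leader i) i * entry i j * entry (leader i) j"
proof -
  let ?r = "leader i"
  have r: "leader j = ?r" "related ?r i" "related ?r j"
    using leader_cong[OF assms(4)] related_leader assms by metis+
  have rr: "leader ?r = ?r" using leader_cong[OF r(2)] .
  have nz: "rayleigh v ?r i \<noteq> 0" "rayleigh v ?r j \<noteq> 0"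
    using rayleigh_related[OF r(2)] rayleigh_related[OF r(3)] assms by auto
  have "entry ?r i = csqrt (rayleigh v ?r i)" "entry ?r j = csqrt (rayleigh v ?r j)"
    "entry i j = cumulant3 v ?r i j / (2 * csqrt (rayleigh v ?r i) * csqrt (rayleigh v ?r j))"
    using assms rr r by (auto simp: entry_def)
  then show ?thesis using nz by simp
qed

text \<open>If \<open>i\<close> is unrelated to \<open>j\<close> or \<open>k\<close>, both sides are
  zero, and triples containing their leader hold by the choice of \<open>entry\<close>. In the
  remaining case only the square is known, and \<open>four_point_sign\<close> with the leader as
  fourth point excludes the wrong sign.\<close>

lemma cumulant3_entry:
  assumes "i < n" "j < n" "k < n" "i \<noteq> j" "i \<noteq> k" "j \<noteq> k"
  shows "cumulant3 v i j k = 2 * entry i j * entry j k * entry i k"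
proof (cases "related i j \<and> related i k")
  case False
  have sq: "(entry i j)\<^sup>2 = rayleigh v i j" "(entry i k)\<^sup>2 = rayleigh v i k"
    using assms by (auto intro: entry_square)
  have "rayleigh v i j = 0 \<or> rayleigh v i k = 0" using False assms by (auto simp: related_def)
  then have "cumulant3 v i j k = 0" "entry i j = 0 \<or> entry i k = 0"
    using cumulant3_square[OF assms] sq by auto
  then show ?thesis by auto
next
  case True
  then have rel: "related i j" "related i k" "related j k"
    using related_sym related_trans by blast+
  let ?r = "leader i"
  have roots: "leader j = ?r" "leader k = ?r" using leader_cong rel by metis+
  have r: "related ?r i" "related ?r j" "related ?r k"
    using related_leader assms roots by metis+
  then have "?r < n" by (simp add: related_def)
  consider "?r = i" | "?r = j" | "?r = k" | "?r \<noteq> i" "?r \<noteq> j" "?r \<noteq> k" by blast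
  then show ?thesis
  proof cases
    case 1
    then show ?thesis using cumulant3_leader[of j k] assms rel roots by (simp add: mult_ac)
  next
    case 2
    then show ?thesis using cumulant3_leader[of i k] assms rel roots cumulant3_perm(1)[of v j i k]
      by (simp add: mult_ac entry_sym[of j])
  next
    case 3
    have "cumulant3 v i j k = cumulant3 v k i j" using cumulant3_perm[of v] by metis
    then show ?thesis using 3 cumulant3_leader[of i j] assms rel roots
      by (simp add: mult_ac entry_sym[of k])
  next
    case 4
    have nz: "entry a b \<noteq> 0" if "a < n" "b < n" "a \<noteq> b" "related a b" for a b
      using entry_square[OF that(1-3)] rayleigh_related[OF that(4,3)] by auto
    have sq: "rayleigh v a b = (entry a b)\<^sup>2" if "related a b" "a \<noteq> b" for a b
      using that entry_square[of a b] by (simp add: related_def)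
    have c: "cumulant3 v ?r i j = 2 * entry ?r i * entry i j * entry ?r j"
      "cumulant3 v ?r i k = 2 * entry ?r i * entry i k * entry ?r k"
      "cumulant3 v ?r j k = 2 * entry ?r j * entry j k * entry ?r k"
      using cumulant3_leader[of i j] cumulant3_leader[of i k] cumulant3_leader[of j k] assms rel roots 4
      by metis+
    have swap: "cumulant3 v i k j = cumulant3 v i j k" "cumulant3 v ?r k j = cumulant3 v ?r j k"
      "cumulant3 v ?r j i = cumulant3 v ?r i j" "cumulant3 v ?r k i = cumulant3 v ?r i k"
      "cumulant3 v j k i = cumulant3 v i j k" "cumulant3 v j k ?r = cumulant3 v ?r j k"
      "cumulant3 v i j ?r = cumulant3 v ?r i j" "cumulant3 v i k ?r = cumulant3 v ?r i k"
      using cumulant3_perm[of v] by metis+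
    have swap4: "cumulant4 v ?r i k j = cumulant4 v ?r i j k" "cumulant4 v ?r j k i = cumulant4 v ?r i j k"
      "cumulant4 v i j k ?r = cumulant4 v ?r i j k"
      using cumulant4_perm[of v] by metis+
    have swap2: "rayleigh v k j = rayleigh v j k" "rayleigh v j i = rayleigh v i j" "rayleigh v k i = rayleigh v i k"
      using rayleigh_commute by metis+
    note sqs = sq[OF r(1) 4(1)] sq[OF r(2) 4(2)] sq[OF r(3) 4(3)] sq[OF rel(1) assms(4)]
      sq[OF rel(2) assms(5)] sq[OF rel(3) assms(6)]
    show ?thesis
    proof (rule trans[OF four_point_sign[of "entry ?r i" "entry ?r j" "entry ?r k" "entry i j" "entry i k" "entry j k"
          "cumulant3 v i j k" "cumulant4 v ?r i j k"]])
      show "(cumulant3 v i j k)\<^sup>2 = 4 * (entry i j)\<^sup>2 * (entry j k)\<^sup>2 * (entry i k)\<^sup>2"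
        using cumulant3_square[OF assms] unfolding sqs .
      show "2 * entry ?r i * entry i j * entry ?r j * cumulant4 v ?r i j k =
        - 2 * (2 * entry ?r i * entry i k * entry ?r k * (entry i j)\<^sup>2 * (entry ?r j)\<^sup>2
          + cumulant3 v i j k * (entry ?r i)\<^sup>2 * (entry ?r j)\<^sup>2
          + 2 * entry ?r j * entry j k * entry ?r k * (entry ?r i)\<^sup>2 * (entry i j)\<^sup>2)"
        using cumulant3_mult_cumulant4[of ?r i j k] assms \<open>?r < n\<close> 4 unfolding c sqs by simp
      show "2 * entry ?r i * entry i k * entry ?r k * cumulant4 v ?r i j k =
        - 2 * (2 * entry ?r i * entry i j * entry ?r j * (entry i k)\<^sup>2 * (entry ?r k)\<^sup>2
          + cumulant3 v i j k * (entry ?r i)\<^sup>2 * (entry ?r k)\<^sup>2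
          + 2 * entry ?r k * entry j k * entry ?r j * (entry ?r i)\<^sup>2 * (entry i k)\<^sup>2)"
        using cumulant3_mult_cumulant4[of ?r i k j] assms \<open>?r < n\<close> 4 unfolding swap swap4 swap2 c sqs by (simp add: mult_ac)
      show "2 * entry ?r j * entry j k * entry ?r k * cumulant4 v ?r i j k =
        - 2 * (2 * entry ?r j * entry i j * entry ?r i * (entry j k)\<^sup>2 * (entry ?r k)\<^sup>2
          + cumulant3 v i j k * (entry ?r j)\<^sup>2 * (entry ?r k)\<^sup>2
          + 2 * entry ?r k * entry i k * entry ?r i * (entry ?r j)\<^sup>2 * (entry j k)\<^sup>2)"
        using cumulant3_mult_cumulant4[of ?r j k i] assms \<open>?r < n\<close> 4 unfolding swap swap4 swap2 c sqs by (simp add: mult_ac)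
      show "cumulant3 v i j k * cumulant4 v ?r i j k =
        - 2 * (2 * entry ?r i * entry i j * entry ?r j * (entry j k)\<^sup>2 * (entry i k)\<^sup>2
          + 2 * entry ?r j * entry j k * entry ?r k * (entry i j)\<^sup>2 * (entry i k)\<^sup>2
          + 2 * entry ?r i * entry i k * entry ?r k * (entry i j)\<^sup>2 * (entry j k)\<^sup>2)"
        using cumulant3_mult_cumulant4[of i j k ?r] assms \<open>?r < n\<close> 4 unfolding swap swap4 swap2 c sqs by (simp add: mult_ac)
    qed (use nz r rel assms \<open>?r < n\<close> 4 in auto)
  qed
qed

definition rep :: "complex mat" where "rep = mat n n (\<lambda>(i, j). entry i j)"

lemma rep_sym: "i < n \<Longrightarrow> j < n \<Longrightarrow> rep $$ (i, j) = rep $$ (j, i)"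
  by (simp add: rep_def entry_sym)

text \<open>The class \<open>C\<close> of \<open>i\<close> is a block of \<open>rep\<close>, so the
  polynomial of its minors is a product of one in the variables of \<open>C\<close> and one in the
  others. A Rayleigh difference across the two factors is zero.\<close>

lemma rayleigh_slice_pminor_rep:
  assumes "i < n" "j < n" "\<not> related i j" "R \<subseteq> {..<n} - {i, j}"
  shows "rayleigh (slice R (pminor n rep) y) i j = 0"
proof -
  define C where "C = {x. related i x}"
  have C: "i \<in> C" "j \<notin> C" using assms by (auto simp: C_def related_def)
  have "rep $$ (a, b) = 0" if "a < n" "b < n" "a \<in> C" "b \<notin> C" for a b
  proof -
    have nr: "\<not> related a b" using that related_trans unfolding C_def by blast
    then have "a \<noteq> b" "rayleigh v a b = 0" using that by (auto simp: related_def)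
    then show ?thesis using that entry_square[of a b] by (simp add: rep_def)
  qed
  then have "pminor n rep S = pminor n rep (S \<inter> C) * pminor n rep (S - C)" for S
    using pminor_Un_block[of n C rep "S \<inter> C" "S - C"] by (simp add: Int_Diff_Un Diff_Int_distrib2)
  moreover have "finite R" using assms(4) by (rule finite_subset) simp
  ultimately have *: "slice R (pminor n rep) y T = slice (R \<inter> C) (pminor n rep) y (T \<inter> C)
      * slice (R - C) (pminor n rep) y (T - C)" for T
    by (intro slice_mult)
  have T: "{i, j} \<inter> C = {i}" "{i, j} - C = {j}" "{i} \<inter> C = {i}" "{i} - C = {}"
    "{j} \<inter> C = {}" "{j} - C = {j}" using C by auto
  show ?thesis unfolding rayleigh_def *[of "{}"] *[of "{i}"] *[of "{j}"] *[of "{i, j}"] T by simp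
qed

text \<open>Strong induction on the size of \<open>I\<close>. Up to three elements the entries were
  chosen to match; from four on, relations valid for both sides determine the top coefficient from
  the smaller ones.\<close>

lemma eq_pminor_rep: "I \<subseteq> {..<n} \<Longrightarrow> v I = pminor n rep I"
proof (induction "card I" arbitrary: I rule: less_induct)
  case less
  have fin: "finite I" using less.prems finite_subset by blast
  have IH: "v S = pminor n rep S" if "S \<subset> I" for S
    using less.hyps[of S] less.prems that psubset_card_mono[OF fin that] by auto
  consider "card I = 0" | "card I = 1" | "card I = 2" | "card I = 3" | "card I \<ge> 4" by linarith
  then show ?case
  proof cases
    case 1
    then show ?thesis using fin by (simp add: empty pminor_empty)
  next
    case 2
    then obtain i where "I = {i}" by (rule card_1_singletonE)
    then show ?thesis using less.prems by (simp add: pminor_1 rep_def entry_def)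
  next
    case 3
    then obtain i j where I: "I = {i, j}" "i \<noteq> j" by (auto simp: card_2_iff)
    then have "pminor n rep I = v {i} * v {j} - (entry i j)\<^sup>2"
      using less.prems entry_sym[of j i]
      by (simp add: pminor_2 rep_def entry_def[of i i] entry_def[of j j] power2_eq_square)
    then show ?thesis using less.prems I by (simp add: entry_square rayleigh_def empty)
  next
    case 4
    then obtain i j k where I: "I = {i, j, k}" "i \<noteq> j" "i \<noteq> k" "j \<noteq> k"
      by (auto simp: card_3_iff)
    then have lt: "i < n" "j < n" "k < n" using less.prems by auto
    have "pminor n rep I = v {i} * v {j} * v {k} - v {i} * (entry j k)\<^sup>2 - v {j} * (entry i k)\<^sup>2
        - v {k} * (entry i j)\<^sup>2 + 2 * entry i j * entry j k * entry i k"
      unfolding I(1) pminor_3[OF lt I(2-4)]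
      using lt entry_sym[of j i] entry_sym[of k i] entry_sym[of k j]
      by (simp add: rep_def entry_def[of i i] entry_def[of j j] entry_def[of k k] power2_eq_square algebra_simps)
    then show ?thesis using lt I(2-4) cumulant3_entry[OF lt I(2-4), symmetric]
      by (simp add: I(1) entry_square rayleigh_def empty cumulant3_def algebra_simps)
  next
    case 5
    show ?thesis
    proof (cases "\<exists>i\<in>I. \<exists>j\<in>I. \<not> related i j")
      case True
      then obtain i j where ij: "i \<in> I" "j \<in> I" "\<not> related i j" by blast
      then have lt: "i < n" "j < n" using less.prems by auto
      have "i \<noteq> j" "rayleigh v i j = 0" using lt ij by (auto simp: related_def)
      have R: "I - {i, j} \<subseteq> {..<n} - {i, j}" using less.prems by blast
      show ?thesis
      proof (rule rayleigh_slice_determines_top[OF fin ij(1,2) \<open>i \<noteq> j\<close> _ IH])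
        show "rayleigh (slice (I - {i, j}) v (\<lambda>_. t)) i j = 0" for t
          by (rule generic[OF lt \<open>i \<noteq> j\<close> \<open>rayleigh v i j = 0\<close> R])
        show "rayleigh (slice (I - {i, j}) (pminor n rep) (\<lambda>_. t)) i j = 0" for t
          by (rule rayleigh_slice_pminor_rep[OF lt ij(3) R])
      qed (simp add: empty)
    next
      \<comment> \<open>The indices in \<open>I\<close> are pairwise related, so any three of them
        serve; a fourth element makes \<open>I\<close> different from the triple.\<close>
      case False
      obtain J where J: "J \<subseteq> I" "card J = 3" 
        using obtain_subset_with_card_n[of 3 I] 5 by auto
      then obtain i j k where Jijk: "J = {i, j, k}" "i \<noteq> j" "i \<noteq> k" "j \<noteq> k" by (auto simp: card_3_iff)
      then have ijk: "i \<in> I" "j \<in> I" "k \<in> I" using J by auto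
      have "I \<noteq> {i, j, k}" using J Jijk 5 by auto
      have lt: "i < n" "j < n" "k < n" using ijk less.prems by auto
      have R: "I - {i, j, k} \<subseteq> {..<n} - {i, j, k}" using less.prems by blast
      show ?thesis
      proof (rule hdet3_slice_determines_top[where v = v, OF fin ijk Jijk(2-4) \<open>I \<noteq> {i, j, k}\<close> empty IH])
        show "hdet3 (slice (I - {i, j, k}) v (\<lambda>_. t)) i j k = 0" for t
          by (rule hdet[OF lt Jijk(2-4) R])
        show "hdet3 (slice (I - {i, j, k}) (pminor n rep) (\<lambda>_. t)) i j k = 0" for t
          by (rule hdet3_slice_pminor[OF rep_sym lt Jijk(2-4) R])
      qed (use rayleigh_related False ijk Jijk in auto)
    qed
  qed
qed

end

subsection \<open>Group action on tensors in terms of index sets\<close>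

definition index_list :: "nat \<Rightarrow> nat set \<Rightarrow> nat list" where
  "index_list n T = map (\<lambda>k. of_bool (k \<in> T)) [0..<n]"

lemma index_list_in_multi_indices [simp]: "index_list n T \<in> multi_indices n"
  by (auto simp: index_list_def multi_indices_def)

lemma length_index_list [simp]: "length (index_list n T) = n"
  by (simp add: index_list_def)

lemma nth_index_list [simp]: "k < n \<Longrightarrow> index_list n T ! k = of_bool (k \<in> T)"
  by (simp add: index_list_def)

lemma index_list_support:
  assumes "I \<in> multi_indices n"
  shows "index_list n {k. k < n \<and> I ! k = 1} = I"
proof (rule nth_equalityI)
  fix k assume "k < length (index_list n {k. k < n \<and> I ! k = 1})"
  then have "k < n" by simp
  moreover have "I ! k \<in> {0, 1}" 
    using assms \<open>k < n\<close> unfolding multi_indices_def by (metis (mono_tags, lifting) mem_Collect_eq nth_mem subset_iff)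
  ultimately show "index_list n {k. k < n \<and> I ! k = 1} ! k = I ! k" by auto
qed (use assms in \<open>simp add: multi_indices_def\<close>)

lemma multi_indices_cases:
  assumes "I \<in> multi_indices n"
  obtains T where "T \<subseteq> {..<n}" "I = index_list n T"
  using index_list_support[OF assms] by (metis (no_types, lifting) lessThan_iff mem_Collect_eq subsetI)

lemma bij_betw_index_list: "bij_betw (index_list n) (Pow {..<n}) (multi_indices n)"
proof (rule bij_betw_byWitness[where f' = "\<lambda>I. {k. k < n \<and> I ! k = 1}"])
  show "\<forall>T\<in>Pow {..<n}. {k. k < n \<and> index_list n T ! k = 1} = T"
    by (auto simp: of_bool_def split: if_splits)
qed (auto simp: index_list_support simp del: One_nat_def)

lemma sl2_act_index_list:
  "sl2_act n g w (index_list n T) = (\<Sum>S\<in>Pow {..<n}. (\<Prod>k\<in>S. g k $$ (of_bool (k \<in> T), 1)) *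
    (\<Prod>k\<in>{..<n} - S. g k $$ (of_bool (k \<in> T), 0)) * w (index_list n S))"
proof -
  have "sl2_act n g w (index_list n T)
      = (\<Sum>S\<in>Pow {..<n}. (\<Prod>k<n. g k $$ (index_list n T ! k, index_list n S ! k)) * w (index_list n S))"
    unfolding sl2_act_def by (simp add: sum.reindex_bij_betw[OF bij_betw_index_list, symmetric])
  also have "\<dots> = (\<Sum>S\<in>Pow {..<n}. (\<Prod>k\<in>S. g k $$ (of_bool (k \<in> T), 1)) *
    (\<Prod>k\<in>{..<n} - S. g k $$ (of_bool (k \<in> T), 0)) * w (index_list n S))"
  proof (rule sum.cong)
    fix S assume "S \<in> Pow {..<n}"
    then have eq: "{..<n} = S \<union> ({..<n} - S)" and fin: "finite S" 
      and sub: "\<And>k. k \<in> S \<Longrightarrow> k < n" using finite_subset by auto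
    have "(\<Prod>k<n. g k $$ (index_list n T ! k, index_list n S ! k))
        = (\<Prod>k\<in>S. g k $$ (index_list n T ! k, index_list n S ! k)) *
          (\<Prod>k\<in>{..<n} - S. g k $$ (index_list n T ! k, index_list n S ! k))"
      by (subst eq, rule prod.union_disjoint) (use fin in auto)
    also have "\<dots> = (\<Prod>k\<in>S. g k $$ (of_bool (k \<in> T), 1)) * (\<Prod>k\<in>{..<n} - S. g k $$ (of_bool (k \<in> T), 0))"
      using sub by (intro arg_cong2[where f = "(*)"] prod.cong) auto
    finally show "(\<Prod>k<n. g k $$ (index_list n T ! k, index_list n S ! k)) * w (index_list n S)
      = (\<Prod>k\<in>S. g k $$ (of_bool (k \<in> T), 1)) * (\<Prod>k\<in>{..<n} - S. g k $$ (of_bool (k \<in> T), 0)) * w (index_list n S)"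
      by simp
  qed simp
  finally show ?thesis .
qed

text \<open>Reindexing factors and index sets along \<open>p\<close> absorbs the permutation;
  afterwards it only affects which three positions enter the hyperdeterminant.\<close>

lemma sl2_act_perm_act:
  assumes p: "p permutes {..<n}"
  shows "sl2_act n g (perm_act n p w) (index_list n T) = sl2_act n (g \<circ> p) w (index_list n {k. p k \<in> T})"
proof -
  have pn: "p k < n \<longleftrightarrow> k < n" for k using permutes_in_image[OF p, of k] by simp
  have perm: "permute_list p (index_list n S) = index_list n {k. p k \<in> S}" for S
    unfolding permute_list_def using pn by (intro nth_equalityI) auto
  have bij: "bij_betw ((`) p) (Pow {..<n}) (Pow {..<n})"
    using bij_betw_Pow[OF permutes_imp_bij[OF p]] .
  have pre: "{k. p k \<in> p ` S} = S" for S using permutes_inj[OF p] by (auto dest: injD)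
  have prod: "(\<Prod>k<n. g k $$ (index_list n T ! k, index_list n (p ` S) ! k))
      = (\<Prod>k<n. (g \<circ> p) k $$ (index_list n {k. p k \<in> T} ! k, index_list n S ! k))" for S
  proof -
    have "(\<Prod>k<n. g k $$ (index_list n T ! k, index_list n (p ` S) ! k))
        = (\<Prod>k<n. g (p k) $$ (index_list n T ! p k, index_list n (p ` S) ! p k))"
      by (rule prod.reindex_bij_betw[OF permutes_imp_bij[OF p], symmetric])
    also have "\<dots> = (\<Prod>k<n. (g \<circ> p) k $$ (index_list n {k. p k \<in> T} ! k, index_list n S ! k))"
      using pn permutes_inj[OF p] by (intro prod.cong) (auto simp: inj_image_mem_iff)
    finally show ?thesis .
  qed
  have "sl2_act n g (perm_act n p w) (index_list n T)
      = (\<Sum>S\<in>Pow {..<n}. (\<Prod>k<n. g k $$ (index_list n T ! k, index_list n S ! k)) * w (index_list n {k. p k \<in> S}))"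
    unfolding sl2_act_def perm_act_def
    by (simp add: sum.reindex_bij_betw[OF bij_betw_index_list, symmetric] perm)
  also have "\<dots> = (\<Sum>S\<in>Pow {..<n}. (\<Prod>k<n. g k $$ (index_list n T ! k, index_list n (p ` S) ! k)) * w (index_list n S))"
    by (subst sum.reindex_bij_betw[OF bij, symmetric]) (simp add: pre)
  also have "\<dots> = sl2_act n (g \<circ> p) w (index_list n {k. p k \<in> T})"
    unfolding prod sl2_act_def by (simp add: sum.reindex_bij_betw[OF bij_betw_index_list, symmetric])
  finally show ?thesis .
qed

lemma hyperdet_eq_hdet3:
  assumes "n \<ge> 3"
  shows "hyperdet n v = hdet3 (\<lambda>T. v (index_list n T)) 0 1 2"
proof -
  have *: "index_list n T = [of_bool (0 \<in> T), of_bool (1 \<in> T), of_bool (2 \<in> T)] @ replicate (n - 3) 0"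
    if T: "T \<subseteq> {0, 1, 2}" for T
  proof (rule nth_equalityI)
    fix k assume "k < length (index_list n T)"
    then have "k < n" by simp
    consider "k = 0" | "k = 1" | "k = 2" | "k \<ge> 3" by linarith
    then show "index_list n T ! k = ([of_bool (0 \<in> T), of_bool (1 \<in> T), of_bool (2 \<in> T)] @ replicate (n - 3) 0) ! k"
    proof cases
      case 4
      then have "k \<notin> T" using T by auto
      then show ?thesis using 4 \<open>k < n\<close> by (simp add: nth_append)
    qed (use \<open>k < n\<close> in auto)
  qed (use assms in simp)
  show ?thesis unfolding hyperdet_def hdet3_def cayley_def Let_def by (simp add: *)
qed

lemma hyperdet_group_act:
  assumes "n \<ge> 3" and p: "p permutes {..<n}"
  shows "hyperdet n (sl2_act n g (perm_act n p w))
    = hdet3 (\<lambda>T. sl2_act n (g \<circ> p) w (index_list n T)) (inv_into UNIV p 0) (inv_into UNIV p 1) (inv_into UNIV p 2)"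
proof -
  have *: "p k = l \<longleftrightarrow> k = inv_into UNIV p l" for k l using permutes_inv_eq[OF p] by metis
  have ins: "{k. p k \<in> insert a T} = insert (inv_into UNIV p a) {k. p k \<in> T}" for a T using * by auto
  then show ?thesis unfolding hyperdet_eq_hdet3[OF assms(1)] sl2_act_perm_act[OF p] hdet3_def ins by simp
qed

lemma minor_vector_index_list:
  assumes "A \<in> carrier_mat n n" "T \<subseteq> {..<n}"
  shows "minor_vector n A t (index_list n T) = t ^ (n - card T) * pminor n A T"
proof -
  have "sum_list (index_list n T) = (\<Sum>k<n. of_bool (k \<in> T))"
    by (simp add: index_list_def sum_list_distinct_conv_sum_set atLeast0LessThan)
  also have "\<dots> = card T"
    using assms(2) by (simp add: of_bool_def sum.If_cases Int_absorb1)
  finally have "sum_list (index_list n T) = card T" .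
  moreover have "{k. k < length (index_list n T) \<and> index_list n T ! k = 1} = T"
    using assms(2) by (auto simp: of_bool_def split: if_splits)
  ultimately show ?thesis
    using assms by (simp add: minor_vector_def principal_minor_def det_submatrix_eq_pminor)
qed

text \<open>The weight \<open>t ^ (n - card S)\<close> supplies one factor \<open>t\<close> for each
  row outside \<open>S\<close>, which gives the sum the shape of
  \<open>det_diag_plus_scaled_rows\<close>.\<close>

lemma sl2_act_minor_vector:
  assumes "A \<in> carrier_mat n n"
  shows "sl2_act n g (minor_vector n A t) (index_list n T) = det (mat n n (\<lambda>(r, c).
      (if r \<in> T then g r $$ (1, 0) else g r $$ (0, 0)) * t * of_bool (r = c)
    + (if r \<in> T then g r $$ (1, 1) else g r $$ (0, 1)) * A $$ (r, c)))"
proof -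
  have "sl2_act n g (minor_vector n A t) (index_list n T) = (\<Sum>S\<in>Pow {..<n}.
      (\<Prod>r\<in>S. if r \<in> T then g r $$ (1, 1) else g r $$ (0, 1)) *
      (\<Prod>r\<in>{..<n} - S. (if r \<in> T then g r $$ (1, 0) else g r $$ (0, 0)) * t) * pminor n A S)"
    unfolding sl2_act_index_list
  proof (rule sum.cong)
    fix S assume "S \<in> Pow {..<n}"
    then have S: "S \<subseteq> {..<n}" by simp
    then have card: "card ({..<n} - S) = n - card S" 
      by (simp add: card_Diff_subset finite_subset)
    have "of_bool (k \<in> T) = (if k \<in> T then 1 else 0 :: nat)" for k by simp
    then show "(\<Prod>k\<in>S. g k $$ (of_bool (k \<in> T), 1)) * (\<Prod>k\<in>{..<n} - S. g k $$ (of_bool (k \<in> T), 0))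
          * minor_vector n A t (index_list n S)
        = (\<Prod>r\<in>S. if r \<in> T then g r $$ (1, 1) else g r $$ (0, 1)) *
          (\<Prod>r\<in>{..<n} - S. (if r \<in> T then g r $$ (1, 0) else g r $$ (0, 0)) * t) * pminor n A S"
      by (simp add: minor_vector_index_list[OF assms S] prod.distrib card mult_ac if_distrib[of "\<lambda>x. g _ $$ (x, _)"] del: One_nat_def)
  qed simp
  then show ?thesis by (simp only: det_diag_plus_scaled_rows)
qed

lemma det_mat_2:
  assumes "g \<in> carrier_mat 2 2"
  shows "det g = g $$ (0, 0) * g $$ (1, 1) - g $$ (0, 1) * (g $$ (1, 0) :: complex)"
proof -
  have "mat 2 2 (\<lambda>(i, j). if i \<in> {0, 1} then g $$ (i, j) else of_bool (i = j)) = g"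
    using assms by (intro eq_matI) auto
  then show ?thesis using pminor_2[of 0 2 1 g] by (simp add: pminor_def)
qed

lemma hyperdet_orbit_minor_vector:
  assumes n: "n \<ge> 3" and p: "p permutes {..<n}" and g: "\<And>k. k < n \<Longrightarrow> g k \<in> SL2"
    and A: "A \<in> symmetric_mats n"
  shows "hyperdet n (sl2_act n g (perm_act n p (minor_vector n A t))) = 0"
proof -
  have carr: "A \<in> carrier_mat n n" and T: "transpose_mat A = A" using A by (auto simp: symmetric_mats_def)
  have sym: "A $$ (i, j) = A $$ (j, i)" if "i < n" "j < n" for i j
    using that carr by (metis T carrier_matD index_transpose_mat(1))
  have inv: "inv_into UNIV p a < n" "inv_into UNIV p a = inv_into UNIV p b \<longleftrightarrow> a = b" if "a < n" for a b
    using that permutes_in_image[OF permutes_inv[OF p], of a] permutes_inj[OF permutes_inv[OF p]]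
    by (auto simp: inj_eq)
  have det: "(g \<circ> p) r $$ (0, 0) * (g \<circ> p) r $$ (1, 1) - (g \<circ> p) r $$ (0, 1) * (g \<circ> p) r $$ (1, 0) = 1"
    if "r < n" for r
  proof -
    have "g (p r) \<in> SL2" using that permutes_in_image[OF p, of r] by (intro g) simp
    then show ?thesis using det_mat_2[of "g (p r)"] by (simp add: SL2_def)
  qed
  show ?thesis
    unfolding hyperdet_group_act[OF n p] sl2_act_minor_vector[OF carr]
    by (rule hdet3_lagrangian[OF sym det]) (use n inv in auto)
qed

section \<open>Homogeneous polynomials and passage to the Zariski closure\<close>

lemma hom_poly_scale: "hom_poly n d f \<Longrightarrow> f (\<lambda>I. c * w I) = c ^ d * f w"
  by (induction rule: hom_poly.induct) (auto simp: algebra_simps power_add)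

lemma hom_poly_cmult: "hom_poly n d f \<Longrightarrow> hom_poly n d (\<lambda>w. c * f w)"
  using hom_poly.mult[OF hom_poly.const[of n c], of d f] by simp

lemma hom_poly_diff: "hom_poly n d f \<Longrightarrow> hom_poly n d f' \<Longrightarrow> hom_poly n d (\<lambda>w. f w - f' w)"
  using hom_poly.add[of n d f "\<lambda>w. - 1 * f' w"] hom_poly_cmult[of n d f' "- 1"] by simp

lemma hom_poly_sum:
  "finite X \<Longrightarrow> X \<noteq> {} \<Longrightarrow> (\<And>x. x \<in> X \<Longrightarrow> hom_poly n d (f x)) \<Longrightarrow> hom_poly n d (\<lambda>w. \<Sum>x\<in>X. f x w)"
  by (induction X rule: finite_ne_induct) (auto intro: hom_poly.add)

lemma hom_poly_mult4:
  assumes "hom_poly n 1 a" "hom_poly n 1 b" "hom_poly n 1 c" "hom_poly n 1 d"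
  shows "hom_poly n 4 (\<lambda>w. x * a w * b w * c w * d w)"
  using hom_poly.mult[OF hom_poly.mult[OF hom_poly.mult[OF hom_poly_cmult[OF assms(1)] assms(2)] assms(3)] assms(4)]
  by (simp add: numeral_eq_Suc)

lemma hom_poly_square_mult_square:
  "hom_poly n 1 a \<Longrightarrow> hom_poly n 1 b \<Longrightarrow> hom_poly n 4 (\<lambda>w. (a w)\<^sup>2 * (b w)\<^sup>2)"
  using hom_poly_mult4[of n a a b b 1] by (simp add: power2_eq_square mult.assoc)

lemma hom_poly_hyperdet:
  assumes "\<And>I. I \<in> multi_indices n \<Longrightarrow> hom_poly n 1 (\<lambda>w. F w I)" "n \<ge> 3"
  shows "hom_poly n 4 (\<lambda>w. hyperdet n (F w))"
  unfolding hyperdet_eq_hdet3[OF assms(2)] hdet3_def cayley_def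
  by (intro hom_poly.add hom_poly_diff hom_poly_mult4 hom_poly_square_mult_square assms(1) index_list_in_multi_indices)

lemma hom_poly_group_act:
  assumes p: "p permutes {..<n}" and I: "I \<in> multi_indices n"
  shows "hom_poly n 1 (\<lambda>w. sl2_act n g (perm_act n p w) I)"
proof -
  have fin: "finite (multi_indices n)" using bij_betw_finite[OF bij_betw_index_list[of n]] by simp
  have perm: "permute_list p J \<in> multi_indices n" if "J \<in> multi_indices n" for J
    using that p by (auto simp: multi_indices_def)
  have "hom_poly n 1 (\<lambda>w. \<Sum>J\<in>multi_indices n. (\<Prod>k<n. g k $$ (I ! k, J ! k)) * w (permute_list p J))"
    using I by (intro hom_poly_sum fin hom_poly_cmult hom_poly.coord perm) auto
  then show ?thesis using I by (simp add: sl2_act_def perm_act_def cong: sum.cong)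
qed

text \<open>For a fixed group element the hyperdeterminant of the image is a homogeneous quartic in
  \<open>w\<close>. It vanishes on the image of the rational map, hence on the closure; the zero
  tensor is reached by scaling with 0.\<close>

lemma hyperdet_orbit_eq_0:
  assumes n: "n \<ge> 3" and p: "p permutes {..<n}" and g: "\<And>k. k < n \<Longrightarrow> g k \<in> SL2"
    and w: "represents_principal_minors n w"
  shows "hyperdet n (sl2_act n g (perm_act n p w)) = 0"
proof -
  let ?f = "\<lambda>w. hyperdet n (sl2_act n g (perm_act n p w))"
  have f: "hom_poly n 4 ?f" by (rule hom_poly_hyperdet[OF hom_poly_group_act[OF p] n])
  have "vanishes_on ?f (minors_image n)"
    using hom_poly_scale[OF f] hyperdet_orbit_minor_vector[OF n p g]
    by (auto simp: vanishes_on_def minors_image_def proj_point_def)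
  moreover from w have "w = (\<lambda>I. 0) \<or> (\<exists>P\<in>minors_variety n. w \<in> P)"
    by (auto simp: represents_principal_minors_def proj_cone_def)
  ultimately show ?thesis
    using f hom_poly_scale[OF f, of 0 w]
    by (auto simp: minors_variety_def zariski_closure_def vanishes_on_def)
qed

subsection \<open>Translation to a generic point\<close>

text \<open>The unipotent elements that act on multi-affine polynomials by translating each variable
  \<open>k\<close> by \<open>y k\<close>.\<close>

definition shear :: "(nat \<Rightarrow> complex) \<Rightarrow> nat \<Rightarrow> complex mat" where
  "shear y k = mat 2 2 (\<lambda>(i, j). if i = 0 \<and> j = 1 then y k else of_bool (i = j))"

lemma shear_in_SL2: "shear y k \<in> SL2"
  using det_mat_2[of "shear y k"] by (simp add: SL2_def shear_def)

text \<open>The coefficients of the polynomial translated by \<open>y\<close>. Only variables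
  outside \<open>T\<close> are evaluated, since those in \<open>T\<close> have been
  differentiated.\<close>

definition taylor :: "nat \<Rightarrow> (nat set \<Rightarrow> complex) \<Rightarrow> (nat \<Rightarrow> complex) \<Rightarrow> nat set \<Rightarrow> complex" where
  "taylor n u y T = slice ({..<n} - T) u y T"

lemma sl2_act_shear:
  assumes "T \<subseteq> {..<n}"
  shows "sl2_act n (shear y) w (index_list n T) = taylor n (\<lambda>S. w (index_list n S)) y T"
proof -
  have "taylor n (\<lambda>S. w (index_list n S)) y T = (\<Sum>S\<in>Pow {..<n}.
      (\<Prod>i\<in>S. if i \<in> T then 1 else if i \<in> {..<n} - T then y i else 0) *
      (\<Prod>i\<in>{..<n} - S. if i \<in> T then 0 else 1) * w (index_list n S))"
    unfolding taylor_def by (rule slice_as_sum_Pow) (use assms in auto)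
  also have "\<dots> = sl2_act n (shear y) w (index_list n T)"
    unfolding sl2_act_index_list
    by (intro sum.cong arg_cong2[where f = "(*)"] prod.cong) (auto simp: shear_def)
  finally show ?thesis by simp
qed

lemma taylor_zero: "taylor n u (\<lambda>_. 0) = u"
  by (simp add: taylor_def slice_zero fun_eq_iff)

lemma taylor_insert:
  assumes "T \<subseteq> {..<n}" "r < n" "r \<notin> T"
  shows "taylor n u y T = slice ({..<n} - insert r T) u y T + y r * taylor n u y (insert r T)"
proof -
  have *: "insert r ({..<n} - insert r T) = {..<n} - T" using assms by auto
  have "slice (insert r ({..<n} - insert r T)) u y T
      = slice ({..<n} - insert r T) u y T + y r * slice ({..<n} - insert r T) u y (insert r T)"
    by (rule slice_insert) auto
  then show ?thesis unfolding taylor_def * .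
qed

text \<open>Successive translations add up. This turns conditions known at every point into
  conditions on slices at one base point.\<close>

lemma slice_taylor:
  assumes "finite R" "R \<subseteq> {..<n} - T" "T \<subseteq> {..<n}"
  shows "slice R (taylor n u y) z T = taylor n u (\<lambda>k. y k + (if k \<in> R then z k else 0)) T"
  using assms
proof (induction R arbitrary: T rule: finite_induct)
  case (insert r R)
  let ?y = "\<lambda>R k. y k + (if k \<in> R then z k else 0)"
  have r: "r < n" "r \<notin> T" using insert.prems by auto
  have 1: "slice R (taylor n u y) z T = taylor n u (?y R) T"
    using insert by (intro insert.IH) auto
  have 2: "slice R (taylor n u y) z (insert r T) = taylor n u (?y R) (insert r T)"
    using insert by (intro insert.IH) auto
  have 3: "slice ({..<n} - insert r T) u (?y (insert r R)) = slice ({..<n} - insert r T) u (?y R)"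
    by (rule slice_cong) auto
  then have "taylor n u (?y (insert r R)) (insert r T) = taylor n u (?y R) (insert r T)"
    by (simp add: taylor_def)
  then show ?case
    using insert.hyps 3 taylor_insert[OF insert.prems(2) r, of u "?y R"]
      taylor_insert[OF insert.prems(2) r, of u "?y (insert r R)"]
    by (simp add: slice_insert 1 2 algebra_simps)
qed simp

lemma polynomial_fun_taylor:
  "(\<And>k. polynomial_fun (\<lambda>s. y s k)) \<Longrightarrow> polynomial_fun (\<lambda>s. taylor n u (y s) T)"
  unfolding taylor_def by (rule polynomial_fun_slice)

text \<open>At the indicator of a minimal set \<open>M\<close> in the support of \<open>u\<close>,
  only the monomial of \<open>M\<close> survives.\<close>

lemma taylor_nonzero:
  assumes "S \<subseteq> {..<n}" "u S \<noteq> 0"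
  shows "\<exists>y. taylor n u y {} \<noteq> 0"
proof -
  obtain M where M: "M \<subseteq> {..<n}" "u M \<noteq> 0" and min: "\<And>S. S \<subset> M \<Longrightarrow> u S = 0"
  proof -
    have "finite S" using assms(1) finite_subset by blast
    then have "\<exists>M. M \<subseteq> S \<and> u M \<noteq> 0 \<and> (\<forall>S. S \<subset> M \<longrightarrow> u S = 0)"
      using assms(2)
    proof (induction S rule: finite_psubset_induct)
      case (psubset S)
      then show ?case by (metis order_refl psubset_imp_subset subset_trans)
    qed
    then show ?thesis using that assms(1) by blast
  qed
  have "taylor n u (\<lambda>k. of_bool (k \<in> M)) {} = (\<Sum>S\<in>{M}. (\<Prod>k\<in>S. of_bool (k \<in> M)) * u (S \<union> {}))"
    unfolding taylor_def slice_def
  proof (rule sum.mono_neutral_right)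
    show "\<forall>S\<in>Pow ({..<n} - {}) - {M}. (\<Prod>k\<in>S. of_bool (k \<in> M)) * u (S \<union> {}) = 0"
    proof
      fix S assume S: "S \<in> Pow ({..<n} - {}) - {M}"
      then have fin: "finite S" using finite_subset by auto
      show "(\<Prod>k\<in>S. of_bool (k \<in> M)) * u (S \<union> {}) = 0"
      proof (cases "S \<subseteq> M")
        case True
        then show ?thesis using S min[of S] by auto
      next
        case False
        then obtain k where "k \<in> S" "k \<notin> M" by blast
        then have "(\<Prod>k\<in>S. of_bool (k \<in> M)) = (0 :: complex)" 
          using fin by (intro prod_zero) auto
        then show ?thesis by simp
      qed
    qed
  qed (use M in auto)
  also have "\<dots> \<noteq> 0" using M by simp
  finally show ?thesis by blast
qed

text \<open>Induction on \<open>F\<close>: on a line joining a good point for the old functions to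
  one for the new function, all of them are nonzero near 0 off a finite set.\<close>

lemma common_nonzero_point:
  assumes "finite F"
    and "\<And>f a b. f \<in> F \<Longrightarrow> polynomial_fun (\<lambda>s. f (\<lambda>k. a k + s * b k))"
    and "\<And>f. f \<in> F \<Longrightarrow> \<exists>y. f y \<noteq> 0"
  shows "\<exists>d :: nat \<Rightarrow> complex. \<forall>f\<in>F. f d \<noteq> 0"
  using assms
proof (induction F rule: finite_induct)
  case (insert f F)
  then obtain d where d: "\<And>g. g \<in> F \<Longrightarrow> g d \<noteq> 0" by blast
  obtain y where y: "f y \<noteq> 0" using insert.prems(2) by blast
  \<comment> \<open>The line meets \<open>d\<close> at \<open>s = 0\<close> and \<open>y\<close> at
    \<open>s = 1\<close>.\<close>
  let ?l = "\<lambda>s k. d k + s * (y k - d k)"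
  have "\<forall>g\<in>insert f F. eventually (\<lambda>s. g (?l s) \<noteq> 0) (at 0)"
  proof
    fix g assume g: "g \<in> insert f F"
    have "g (?l (if g = f then 1 else 0)) \<noteq> 0" using g y d by auto
    with insert.prems(1)[OF g] show "eventually (\<lambda>s. g (?l s) \<noteq> 0) (at 0)"
      by (rule polynomial_fun_eventually_nonzero[of "\<lambda>s. g (?l s)"])
  qed
  then have "eventually (\<lambda>s. \<forall>g\<in>insert f F. g (?l s) \<noteq> 0) (at 0)"
    using insert.hyps by (intro eventually_ball_finite) auto
  then have "\<exists>s. \<forall>g\<in>insert f F. g (?l s) \<noteq> 0" using eventually_happens'[OF at_neq_bot] by blast
  then show ?case by blast
qed simp

text \<open>Dividing by the constant term scales hyperdeterminants by a fourth power and Rayleigh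
  differences by a square, and \<open>slice_taylor\<close> moves the base point.\<close>

lemma normalized_taylor:
  assumes H: "\<And>i j k y. i < n \<Longrightarrow> j < n \<Longrightarrow> k < n \<Longrightarrow> i \<noteq> j \<Longrightarrow> i \<noteq> k \<Longrightarrow> j \<noteq> k \<Longrightarrow>
      hdet3 (taylor n u y) i j k = 0"
    and nz: "taylor n u y0 {} \<noteq> 0"
    and gen: "\<And>i j y. i < n \<Longrightarrow> j < n \<Longrightarrow> i \<noteq> j \<Longrightarrow> rayleigh (taylor n u y0) i j = 0 \<Longrightarrow>
      rayleigh (taylor n u y) i j = 0"
  shows "normalized_tensor n (\<lambda>T. inverse (taylor n u y0 {}) * taylor n u y0 T)"
proof
  let ?c = "inverse (taylor n u y0 {})"
  let ?v = "\<lambda>T. ?c * taylor n u y0 T"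
  have slice: "slice R ?v y T = ?c * taylor n u (\<lambda>k. y0 k + (if k \<in> R then y k else 0)) T"
    if "R \<subseteq> {..<n} - T" "T \<subseteq> {..<n}" for R y T
    using that finite_subset[OF that(1)] by (simp add: slice_cmult slice_taylor)
  show "?v {} = 1" using nz by simp
  show "hdet3 (slice R ?v y) i j k = 0"
    if "i < n" "j < n" "k < n" "i \<noteq> j" "i \<noteq> k" "j \<noteq> k" "R \<subseteq> {..<n} - {i, j, k}" for i j k R y
  proof -
    have "hdet3 (slice R ?v y) i j k
        = hdet3 (\<lambda>T. ?c * taylor n u (\<lambda>k. y0 k + (if k \<in> R then y k else 0)) T) i j k"
      using that by (intro hdet3_cong slice) auto
    also have "\<dots> = 0" unfolding hdet3_scale using H that by simp
    finally show ?thesis .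
  qed
  show "rayleigh (slice R ?v y) i j = 0"
    if "i < n" "j < n" "i \<noteq> j" "rayleigh ?v i j = 0" "R \<subseteq> {..<n} - {i, j}" for i j R y
  proof -
    have scale: "rayleigh (\<lambda>T. ?c * x T) i j = ?c\<^sup>2 * rayleigh x i j" for x
      by (simp add: rayleigh_def power2_eq_square algebra_simps)
    have "rayleigh (slice R ?v y) i j
        = rayleigh (\<lambda>T. ?c * taylor n u (\<lambda>k. y0 k + (if k \<in> R then y k else 0)) T) i j"
      unfolding rayleigh_def using that by (intro arg_cong2[where f = "(-)"] arg_cong2[where f = "(*)"] slice) auto
    moreover have "rayleigh (taylor n u y0) i j = 0" using that(4) nz unfolding scale by simp
    ultimately show ?thesis unfolding scale using gen[OF that(1-3)] by simp
  qed
qed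

text \<open>The points unfit as base points are zeros of finitely many nonzero polynomials. For a
  direction \<open>d\<close> off these zero sets, \<open>s * d\<close> is a good base point for all
  small nonzero \<open>s\<close>.\<close>

lemma eventually_taylor_eq_pminor:
  assumes H: "\<And>i j k y. i < n \<Longrightarrow> j < n \<Longrightarrow> k < n \<Longrightarrow> i \<noteq> j \<Longrightarrow> i \<noteq> k \<Longrightarrow> j \<noteq> k \<Longrightarrow>
      hdet3 (taylor n u y) i j k = 0"
    and S: "S \<subseteq> {..<n}" "u S \<noteq> 0"
  obtains d where "eventually (\<lambda>s. \<exists>c A. c \<noteq> 0 \<and> A \<in> symmetric_mats n \<and>
    (\<forall>T\<subseteq>{..<n}. taylor n u (\<lambda>k. s * d k) T = c * pminor n A T)) (at 0)"
proof -
  \<comment> \<open>The functions to be kept nonzero: the polynomial itself and every Rayleigh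
    difference that is not identically zero.\<close>
  define F where "F = insert (\<lambda>y. taylor n u y {}) ((\<lambda>(i, j) y. rayleigh (taylor n u y) i j) `
    {(i, j). i < n \<and> j < n \<and> (\<exists>y. rayleigh (taylor n u y) i j \<noteq> 0)})"
  have "finite {(i, j). i < n \<and> j < n \<and> (\<exists>y. rayleigh (taylor n u y) i j \<noteq> 0)}"
    by (rule finite_subset[of _ "{..<n} \<times> {..<n}"]) auto
  then have fin: "finite F" unfolding F_def by simp
  have poly: "polynomial_fun (\<lambda>s. f (\<lambda>k. a k + s * b k))" if "f \<in> F" for f a b
  proof -
    have "polynomial_fun (\<lambda>s. taylor n u (\<lambda>k. a k + s * b k) T)" for T
      by (intro polynomial_fun_taylor polynomial_fun_intros polynomial_fun_const polynomial_fun_ident)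
    then show ?thesis using that unfolding F_def
      by (auto simp: rayleigh_def intro!: polynomial_fun_diff polynomial_fun_mult)
  qed
  have "\<exists>y. f y \<noteq> 0" if "f \<in> F" for f
    using that taylor_nonzero[of S n u] S unfolding F_def by auto
  then obtain d where d: "\<And>f. f \<in> F \<Longrightarrow> f d \<noteq> 0"
    using common_nonzero_point[OF fin poly] by blast
  have "\<forall>f\<in>F. eventually (\<lambda>s. f (\<lambda>k. s * d k) \<noteq> 0) (at 0)"
  proof
    fix f assume f: "f \<in> F"
    show "eventually (\<lambda>s. f (\<lambda>k. s * d k) \<noteq> 0) (at 0)"
      using poly[OF f, of "\<lambda>_. 0" d] d[OF f]
      by (intro polynomial_fun_eventually_nonzero[of "\<lambda>s. f (\<lambda>k. s * d k)" 1]) auto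
  qed
  then have "eventually (\<lambda>s. \<forall>f\<in>F. f (\<lambda>k. s * d k) \<noteq> 0) (at 0)"
    using fin by (intro eventually_ball_finite)
  then have "eventually (\<lambda>s. \<exists>c A. c \<noteq> 0 \<and> A \<in> symmetric_mats n \<and>
    (\<forall>T\<subseteq>{..<n}. taylor n u (\<lambda>k. s * d k) T = c * pminor n A T)) (at 0)"
  proof eventually_elim
    case (elim s)
    let ?y = "\<lambda>k. s * d k"
    have nz: "taylor n u ?y {} \<noteq> 0" using elim by (simp add: F_def)
    have gen: "rayleigh (taylor n u y) i j = 0"
      if "i < n" "j < n" "i \<noteq> j" "rayleigh (taylor n u ?y) i j = 0" for i j y
    proof (rule ccontr)
      assume "rayleigh (taylor n u y) i j \<noteq> 0"
      then have "(\<lambda>y. rayleigh (taylor n u y) i j) \<in> F"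
        using that unfolding F_def by (intro insertI2 image_eqI[of _ _ "(i, j)"]) auto
      from bspec[OF elim this] show False using that by simp
    qed
    interpret normalized_tensor n "\<lambda>T. inverse (taylor n u ?y {}) * taylor n u ?y T"
      by (rule normalized_taylor[OF H nz gen])
    have "rep \<in> symmetric_mats n"
      by (auto simp: symmetric_mats_def rep_def intro!: eq_matI entry_sym)
    moreover have "taylor n u ?y T = taylor n u ?y {} * pminor n rep T" if "T \<subseteq> {..<n}" for T
      using eq_pminor_rep[OF that] nz by (simp add: field_simps)
    ultimately show ?case using nz by blast
  qed
  then show thesis by (rule that)
qed

section \<open>From the vanishing on the orbit to membership in the closure\<close>

text \<open>A permutation moves \<open>i\<close>, \<open>j\<close>, \<open>k\<close> to the first
  three positions, and a shear translates to \<open>y\<close>; both lie in the group.\<close>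

lemma hdet3_taylor_eq_0:
  assumes orbit: "\<And>v. v \<in> orbit_tensor n w \<Longrightarrow> hyperdet n v = 0"
    and ijk: "i < n" "j < n" "k < n" "i \<noteq> j" "i \<noteq> k" "j \<noteq> k"
  shows "hdet3 (taylor n (\<lambda>S. w (index_list n S)) y) i j k = 0"
proof -
  have n: "n \<ge> 3" using ijk by linarith
  \<comment> \<open>Each transposition puts one more index into place and fixes those already
    placed.\<close>
  define p1 where "p1 = transpose 0 i"
  define p2 where "p2 = transpose 1 (p1 j)"
  define p3 where "p3 = transpose 2 (p2 (p1 k))"
  define p where "p = p3 \<circ> p2 \<circ> p1"
  have lt: "p1 j < n" "p2 (p1 k) < n" using ijk n by (auto simp: p1_def p2_def transpose_def)
  have p: "p permutes {..<n}" unfolding p_def p3_def p2_def p1_def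
    using lt ijk n by (intro permutes_compose permutes_swap_id) (auto simp: p1_def p2_def)
  have p1: "p1 i = 0" "p1 j \<noteq> 0" "p1 k \<noteq> 0" "p1 j \<noteq> p1 k"
    using ijk by (auto simp: p1_def transpose_def)
  then have p2: "p2 0 = 0" "p2 (p1 j) = 1" "p2 (p1 k) \<noteq> 0" "p2 (p1 k) \<noteq> 1"
    by (auto simp: p2_def transpose_def)
  then have p3: "p3 0 = 0" "p3 1 = 1" "p3 (p2 (p1 k)) = 2"
    by (auto simp: p3_def transpose_def)
  have pi: "p i = 0" "p j = 1" "p k = 2"
    by (simp_all only: p_def o_apply p1(1) p2(1,2) p3)
  have ip: "inv_into UNIV p (p x) = x" for x using permutes_inverses(2)[OF p] .
  \<comment> \<open>The translation vector is relabelled by the inverse of \<open>p\<close>, so that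
    \<open>g \<circ> p\<close> is the shear by \<open>y\<close>.\<close>
  define g where "g = shear (\<lambda>k. y (inv_into UNIV p k))"
  have gp: "g \<circ> p = shear y" by (auto simp: g_def shear_def ip fun_eq_iff)
  have "sl2_act n g (perm_act n p w) \<in> orbit_tensor n w"
    unfolding orbit_tensor_def mem_Collect_eq g_def using p shear_in_SL2 by blast
  from orbit[OF this] have "hdet3 (\<lambda>T. sl2_act n (shear y) w (index_list n T)) i j k = 0"
    unfolding hyperdet_group_act[OF n p] gp using ip[of i] ip[of j] ip[of k] pi by simp
  moreover have "hdet3 (\<lambda>T. sl2_act n (shear y) w (index_list n T)) i j k
      = hdet3 (taylor n (\<lambda>S. w (index_list n S)) y) i j k"
    using ijk by (intro hdet3_cong sl2_act_shear) auto
  ultimately show ?thesis by simp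
qed

lemma polynomial_fun_hom_poly:
  assumes "hom_poly n d f" "\<And>I. polynomial_fun (\<lambda>s. W s I)"
  shows "polynomial_fun (\<lambda>s. f (W s))"
  using assms(1) by induction (simp_all add: assms(2) polynomial_fun_add polynomial_fun_mult)

text \<open>The translates \<open>W s\<close> tend to \<open>w\<close> and are multiples of minor
  vectors for small nonzero \<open>s\<close>. Since \<open>f (W s)\<close> is polynomial in
  \<open>s\<close>, its vanishing there extends to \<open>s = 0\<close>.\<close>

lemma hom_poly_vanishes_at:
  assumes f: "hom_poly n d f" "vanishes_on f (minors_image n)"
    and w: "w \<in> tensors n" "w \<noteq> (\<lambda>I. 0)"
    and orbit: "\<And>v. v \<in> orbit_tensor n w \<Longrightarrow> hyperdet n v = 0"
  shows "f w = 0"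
proof -
  let ?u = "\<lambda>S. w (index_list n S)"
  obtain I where I: "w I \<noteq> 0" using w(2) by auto
  then have "I \<in> multi_indices n" using w(1) by (auto simp: tensors_def)
  then obtain S where S: "S \<subseteq> {..<n}" "I = index_list n S" by (rule multi_indices_cases)
  obtain e where ev: "eventually (\<lambda>s. \<exists>c A. c \<noteq> 0 \<and> A \<in> symmetric_mats n \<and>
    (\<forall>T\<subseteq>{..<n}. taylor n ?u (\<lambda>k. s * e k) T = c * pminor n A T)) (at 0)"
    using eventually_taylor_eq_pminor[OF hdet3_taylor_eq_0[OF orbit] S(1)] I S(2) by blast
  define W where "W s = sl2_act n (shear (\<lambda>k. s * e k)) w" for s
  have W: "W s (index_list n T) = taylor n ?u (\<lambda>k. s * e k) T" if "T \<subseteq> {..<n}" for s T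
    unfolding W_def by (rule sl2_act_shear[OF that])
  have W_out: "W s J = 0" if "J \<notin> multi_indices n" for s J
    using that by (simp add: W_def sl2_act_def)
  have poly: "polynomial_fun (\<lambda>s. W s J)" for J
  proof (cases "J \<in> multi_indices n")
    case True
    then obtain T where "T \<subseteq> {..<n}" "J = index_list n T" by (rule multi_indices_cases)
    then show ?thesis
      by (auto simp: W intro!: polynomial_fun_taylor polynomial_fun_intros)
  qed (simp add: W_out)
  have W0: "W 0 = w"
  proof
    fix J show "W 0 J = w J"
    proof (cases "J \<in> multi_indices n")
      case True
      then obtain T where "T \<subseteq> {..<n}" "J = index_list n T" by (rule multi_indices_cases)
      then show ?thesis by (simp add: W taylor_zero)
    qed (use w(1) in \<open>simp add: W_out tensors_def\<close>)
  qed
  from ev have "eventually (\<lambda>s. f (W s) = 0) (at 0)"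
  proof eventually_elim
    case (elim s)
    then obtain c A where c: "c \<noteq> 0" and A: "A \<in> symmetric_mats n"
      and eq: "\<And>T. T \<subseteq> {..<n} \<Longrightarrow> taylor n ?u (\<lambda>k. s * e k) T = c * pminor n A T" by blast
    have carr: "A \<in> carrier_mat n n" using A by (simp add: symmetric_mats_def)
    have Ws: "W s = (\<lambda>J. c * minor_vector n A 1 J)"
    proof
      fix J show "W s J = c * minor_vector n A 1 J"
      proof (cases "J \<in> multi_indices n")
        case True
        then obtain T where "T \<subseteq> {..<n}" "J = index_list n T" by (rule multi_indices_cases)
        then show ?thesis by (simp add: W eq minor_vector_index_list[OF carr])
      qed (simp add: W_out minor_vector_def)
    qed
    have "minor_vector n A 1 (index_list n {}) \<noteq> 0"
      by (simp add: minor_vector_index_list[OF carr] pminor_empty)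
    then have "minor_vector n A 1 \<noteq> (\<lambda>I. 0)" by metis
    then have "proj_point (minor_vector n A 1) \<in> minors_image n"
      using A by (auto simp: minors_image_def)
    moreover have "W s \<in> proj_point (minor_vector n A 1)"
      using c unfolding Ws proj_point_def by blast
    ultimately show ?case using f(2) by (auto simp: vanishes_on_def)
  qed
  from polynomial_fun_eq_0[OF polynomial_fun_hom_poly[OF f(1) poly] this, of 0]
  show ?thesis by (simp add: W0)
qed

theorem corollary1p4:
  fixes n :: nat and w :: tensor
  assumes "n \<ge> 3" and "w \<in> tensors n"
  shows "represents_principal_minors n w \<longleftrightarrow>
    hyperdet n w = 0 \<and> (\<forall>v\<in>orbit_tensor n w. hyperdet n v = 0)"
proof
  assume w: "represents_principal_minors n w"
  have "hyperdet n v = 0" if "v \<in> orbit_tensor n w" for v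
    using that hyperdet_orbit_eq_0[OF assms(1) _ _ w] by (auto simp: orbit_tensor_def)
  moreover have "hyperdet n w = 0"
  proof -
    \<comment> \<open>\<open>w\<close> lies in its own orbit, by the identity permutation and the
      shear by 0.\<close>
    have "hyperdet n (sl2_act n (shear (\<lambda>_. 0)) (perm_act n id w)) = 0"
      by (rule hyperdet_orbit_eq_0[OF assms(1) permutes_id shear_in_SL2 w])
    also have "hyperdet n (sl2_act n (shear (\<lambda>_. 0)) (perm_act n id w))
        = hdet3 (\<lambda>T. sl2_act n (shear (\<lambda>_. 0)) w (index_list n T)) 0 1 2"
      by (simp add: hyperdet_group_act[OF assms(1) permutes_id])
    also have "\<dots> = hdet3 (\<lambda>T. w (index_list n T)) 0 1 2"
      using assms(1) by (intro hdet3_cong) (subst sl2_act_shear, auto simp: taylor_zero)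
    finally show ?thesis by (simp add: hyperdet_eq_hdet3[OF assms(1)])
  qed
  ultimately show "hyperdet n w = 0 \<and> (\<forall>v\<in>orbit_tensor n w. hyperdet n v = 0)" by blast
next
  assume orbit: "hyperdet n w = 0 \<and> (\<forall>v\<in>orbit_tensor n w. hyperdet n v = 0)"
  show "represents_principal_minors n w"
  proof (cases "w = (\<lambda>I. 0)")
    case True
    then show ?thesis by (simp add: represents_principal_minors_def proj_cone_def)
  next
    case False
    have "vanishes_on f {proj_point w}"
      if f: "hom_poly n d f" "vanishes_on f (minors_image n)" for d f
    proof -
      have "f w = 0" using hom_poly_vanishes_at[OF f assms(2) False] orbit by blast
      then show ?thesis using hom_poly_scale[OF f(1)] by (auto simp: vanishes_on_def proj_point_def)
    qed
    then have "proj_point w \<in> minors_variety n"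
      using assms(2) False by (auto simp: minors_variety_def zariski_closure_def proj_space_def)
    moreover have "w \<in> proj_point w" unfolding proj_point_def by (auto intro!: exI[of _ 1])
    ultimately show ?thesis by (auto simp: represents_principal_minors_def proj_cone_def)
  qed
qed

end
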